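(* Let $b$ be a prime, let $m,s,d\in\mathbb{N}$, let $\boldsymbol{u}=(u_j)_{j\in\mathbb{N}}$ be a sequence of weights with $u_1\ge u_2\ge\cdots>0$, and let $p\in\mathbb{Z}_b[x]$ be irreducible with $\deg(p)=m$. Let $\phi:[0,\infty)\to[0,\infty)$ be a concave and unbounded monotonic increasing function. Suppose that $\boldsymbol{q}=(q_1,\ldots,q_{ds})$ is constructed by the component-by-component algorithm (described in the context) with modulus $p$. Then $$B_{\boldsymbol{u}}(\boldsymbol{q},p)\le \phi^{-1}\left[\frac{1}{b^m-1}\sum_{\substack{\boldsymbol{k}\in\mathbb{N}_0^s\setminus\{\boldsymbol{0}\}\\ k_j<b^{dm}\ \forall j}}\phi\left(b^{-\mu(\boldsymbol{a};\boldsymbol{k})}\right)\right].$$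
   Context: $\mathbb{N}$ is the set of positive integers, $\mathbb{N}_0=\mathbb{N}\cup\{0\}$. $\mathbb{Z}_b$ is the field with $b$ elements, identified with $\{0,\dots,b-1\}$. The sequence $\boldsymbol a$. Put $m_b=2\sin(\pi/b)$; $M_b=2$ if $b$ is even and $M_b=2\sin((b+1)\pi/(2b))$ if $b$ is odd; $C_b=2$ if $b=2$ and $C_b=M_b+\frac{b m_b}{b-M_b}$ if $b\neq2$. Then $\boldsymbol{a}=(a_j)_{j\in\mathbb{N}}$ with $a_j=-\log_b(C_b m_b^{-1}u_j)$. The function $\mu$. For $a\in\mathbb{R}$ and $k\in\mathbb{N}$ with $b$-adic expansion $k=\kappa_1b^{c_1-1}+\cdots+\kappa_vb^{c_v-1}$, $\kappa_i\in\{1,\dots,b-1\}$, $c_1>\cdots>c_v>0$, set $\mu(a;k)=\sum_{i=1}^v(c_i+a)$, and $\mu(a;0)=0$. For $\boldsymbol{k}=(k_1,\dots,k_s)\in\mathbb{N}_0^s$, $\mu(\boldsymbol{a};\boldsymbol{k})=\sum_{j=1}^s\mu(a_j;k_j)$. Polynomial lattice points. $\mathbb{Z}_b((x^{-1}))$ is the field of formal Laurent series; $v_m:\mathbb{Z}_b((x^{-1}))\to[0,1)$ is $v_m(\sum_{l=w}^\infty t_lx^{-l})=\sum_{l=\max(1,w)}^m t_lb^{-l}$. An integer $0\le n<b^m$ with $n=\nu_0+\nu_1b+\cdots$ is identified with the polynomial $n(x)=\nu_0+\nu_1x+\cdots\in\mathbb{Z}_b[x]$. For $\boldsymbol q=(q_1,q_2,\dots)$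 a vector of polynomials in $\mathbb{Z}_b[x]$, put $x_{n,j}=v_m(n(x)q_j(x)/p(x))$ for $0\le n<b^m$, with $b$-adic expansion $x_{n,j}=\sum_{i\ge1}\xi_{i,n,j}b^{-i}$, $\xi_{i,n,j}\in\{0,\dots,b-1\}$ (infinitely many digits different from $b-1$). The criterion. Let $\eta(0)=b-1$ and $\eta(\xi)=-1$ for $\xi\in\{1,\dots,b-1\}$. For $1\le\tau\le ds$, $\boldsymbol{q}_\tau=(q_1,\dots,q_\tau)\in(\mathbb{Z}_b[x])^\tau$ and $\beta=\lceil\tau/d\rceil$, $$B_{\boldsymbol{u}}(\boldsymbol{q}_\tau,p)=-1+\frac1{b^m}\sum_{n=0}^{b^m-1}\prod_{j=1}^{\beta-1}\prod_{h=1}^{d}\prod_{i=1}^{m}\left\{1+\frac{\eta(\xi_{i,n,d(j-1)+h})}{b^{d(i-1)+h+a_j}}\right\}\prod_{h=1}^{\tau-d(\beta-1)}\prod_{i=1}^m\left\{1+\frac{\eta(\xi_{i,n,d(\beta-1)+h})}{b^{d(i-1)+h+a_\beta}}\right\}.$$ For $\tau=ds$ write $B_{\boldsymbol u}(\boldsymbol q,p)$. Component-by-component algorithm. Let $R_{b,m}=\{q\in\mathbb{Z}_b[x]:\deg(q)<m,\ q\ne0\}$. Given the irreducible $p$ with $\deg(p)=m$: set $q_1=1$; for $\tau=2,\dots,ds$, choose $q_\tau\in R_{b,m}$ minimizing $q\mapsto B_{\boldsymbol{u}}((\boldsymbol{q}_{\tau-1},q),p)$ over $q\in R_{b,m}$,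 where $\boldsymbol{q}_{\tau-1}=(q_1,\dots,q_{\tau-1})$. *)

theory Defs
  imports
    "HOL-Analysis.Analysis"
    "HOL-Computational_Algebra.Formal_Laurent_Series"
    "Berlekamp_Zassenhaus.Finite_Field"
begin

section \<open>Conventions\<close>

text \<open>
  The field with \<open>b\<close> elements is the type \<open>'p mod_ring\<close> with \<open>'p :: prime_card\<close> and
  \<open>b = CARD('p)\<close>; its identification with \<open>{0..b-1}\<close> is \<^const>\<open>to_int_mod_ring\<close>.
  Sequences and vectors indexed from 1 are functions on \<^typ>\<open>nat\<close> of which only the values at
  positive indices (within range) are used.
\<close>

section \<open>The sequence \<open>a\<close> and the function \<open>\<mu>\<close>\<close>

definition m_const :: "nat \<Rightarrow> real" where
  "m_const b = 2 * sin (pi / real b)"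

definition M_const :: "nat \<Rightarrow> real" where
  "M_const b = (if even b then 2 else 2 * sin ((real b + 1) * pi / (2 * real b)))"

definition C_const :: "nat \<Rightarrow> real" where
  "C_const b = (if b = 2 then 2
     else M_const b + real b * m_const b / (real b - M_const b))"

definition a_seq :: "nat \<Rightarrow> (nat \<Rightarrow> real) \<Rightarrow> nat \<Rightarrow> real" where
  "a_seq b u j = - log (real b) (C_const b * inverse (m_const b) * u j)"

text \<open>
  In \<open>k = \<kappa>\<^sub>1 b^(c\<^sub>1 - 1) + \<dots> + \<kappa>\<^sub>v b^(c\<^sub>v - 1)\<close> with nonzero \<open>\<kappa>\<^sub>i\<close>, the \<open>c\<^sub>i\<close> are the positions
  (counted from 1) of the nonzero \<open>b\<close>-adic digits of \<open>k\<close>.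
\<close>

definition mu :: "nat \<Rightarrow> real \<Rightarrow> nat \<Rightarrow> real" where
  "mu b a k = (\<Sum>c | c \<ge> 1 \<and> k div b ^ (c - 1) mod b \<noteq> 0. real c + a)"

definition mu_vec :: "nat \<Rightarrow> nat \<Rightarrow> (nat \<Rightarrow> real) \<Rightarrow> (nat \<Rightarrow> nat) \<Rightarrow> real" where
  "mu_vec b s a k = (\<Sum>j = 1..s. mu b (a j) (k j))"

section \<open>Polynomial lattice points\<close>

text \<open>
  The variable \<^const>\<open>fls_X\<close> of the library's Laurent series plays the role of \<open>x\<^sup>-\<^sup>1\<close>, so that
  \<open>\<Sum> t\<^sub>l x^(-l)\<close> is the series with coefficients \<open>fls_nth f l = t\<^sub>l\<close>, and a polynomial in \<open>x\<close> is
  embedded by evaluating it at \<^const>\<open>fls_X_inv\<close>.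
\<close>

definition laurent_of_poly :: "'a::field poly \<Rightarrow> 'a fls" where
  "laurent_of_poly q = poly (map_poly fls_const q) fls_X_inv"

definition v_trunc :: "nat \<Rightarrow> 'p::prime_card mod_ring fls \<Rightarrow> real" where
  "v_trunc m f =
     (\<Sum>l = 1..m. real_of_int (to_int_mod_ring (fls_nth f (int l))) / real CARD('p) ^ l)"

text \<open>For \<open>n < b^m\<close> all \<open>b\<close>-adic digits of \<open>n\<close> are covered by the sum.\<close>

definition poly_of_nat :: "nat \<Rightarrow> nat \<Rightarrow> 'p::prime_card mod_ring poly" where
  "poly_of_nat m n = (\<Sum>i<m. Polynomial.monom (of_nat (n div CARD('p) ^ i mod CARD('p))) i)"

definition lattice_coord ::
  "nat \<Rightarrow> 'p::prime_card mod_ring poly \<Rightarrow> 'p mod_ring poly \<Rightarrow> nat \<Rightarrow> real" where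
  "lattice_coord m p q n =
     v_trunc m (laurent_of_poly (poly_of_nat m n * q) / laurent_of_poly p)"

text \<open>
  The \<open>i\<close>-th digit (\<open>i \<ge> 1\<close>) of \<open>x \<in> [0,1)\<close> in its \<open>b\<close>-adic expansion with infinitely many digits
  different from \<open>b - 1\<close>; see the lemma below.
\<close>

definition badic_digit :: "nat \<Rightarrow> real \<Rightarrow> nat \<Rightarrow> nat" where
  "badic_digit b x i = nat (\<lfloor>x * real b ^ i\<rfloor> mod int b)"

lemma badic_digit_expansion:
  fixes b :: nat and x :: real
  assumes b: "b \<ge> 2" and x: "0 \<le> x" "x < 1"
  shows "badic_digit b x i < b"
    and "(\<lambda>i. real (badic_digit b x (Suc i)) / real b ^ Suc i) sums x"
    and "\<exists>\<^sub>\<infinity>i. badic_digit b x i \<noteq> b - 1"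
proof -
  show "badic_digit b x i < b"
    using b by (simp add: badic_digit_def nat_less_iff)
  define F where "F i = \<lfloor>x * real b ^ i\<rfloor>" for i
  have step: "F (Suc i) = int b * F i + int (badic_digit b x (Suc i))" for i
  proof -
    have "F i = F (Suc i) div int b"
      using floor_divide_real_eq_div[of "int b" "x * real b ^ Suc i"] b
      by (simp add: F_def)
    moreover have "int (badic_digit b x (Suc i)) = F (Suc i) mod int b"
      using b by (simp add: badic_digit_def F_def)
    ultimately show ?thesis
      by simp
  qed
  have F0: "F 0 = 0"
    using x by (simp add: F_def floor_eq_iff)
  have partial: "(\<Sum>i<N. real (badic_digit b x (Suc i)) / real b ^ Suc i)
      = real_of_int (F N) / real b ^ N" for N
  proof (induction N)
    case 0
    then show ?case by (simp add: F0)
  next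
    case (Suc N)
    then show ?case
      using b by (simp add: step field_simps)
  qed
  have lower: "real_of_int (F N) / real b ^ N \<le> x" for N
    using b by (simp add: F_def divide_le_eq)
  have upper: "x < real_of_int (F N) / real b ^ N + 1 / real b ^ N" for N
  proof -
    have "x * real b ^ N < real_of_int (F N) + 1"
      unfolding F_def by linarith
    then show ?thesis
      using b by (simp add: field_simps)
  qed
  have lim0: "(\<lambda>N. 1 / real b ^ N) \<longlonglongrightarrow> 0"
    using b LIMSEQ_inverse_realpow_zero[of "real b"] by (simp add: divide_inverse)
  have "(\<lambda>N. real_of_int (F N) / real b ^ N) \<longlonglongrightarrow> x"
  proof (rule tendsto_sandwich)
    show "\<forall>\<^sub>F N in sequentially. x - 1 / real b ^ N \<le> real_of_int (F N) / real b ^ N"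
      using upper by (intro always_eventually allI) (smt (verit))
    show "\<forall>\<^sub>F N in sequentially. real_of_int (F N) / real b ^ N \<le> x"
      using lower by simp
    show "(\<lambda>N. x - 1 / real b ^ N) \<longlonglongrightarrow> x"
      using tendsto_diff[OF tendsto_const lim0, of x] by simp
  qed simp
  then show "(\<lambda>i. real (badic_digit b x (Suc i)) / real b ^ Suc i) sums x"
    by (simp only: sums_def partial)
  show "\<exists>\<^sub>\<infinity>i. badic_digit b x i \<noteq> b - 1"
  proof (rule ccontr)
    assume "\<not> ?thesis"
    then obtain K where K: "\<And>i. i \<ge> K \<Longrightarrow> badic_digit b x i = b - 1"
      by (auto simp: INFM_nat_le)
    have shift: "real_of_int (F (K + n)) + 1 = real b ^ n * (real_of_int (F K) + 1)" for n
    proof (induction n)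
      case (Suc n)
      have "real_of_int (F (K + Suc n)) + 1 = real b * (real_of_int (F (K + n)) + 1)"
        using b K[of "Suc (K + n)"] by (simp add: step algebra_simps of_nat_diff)
      with Suc show ?case by simp
    qed simp
    define e where "e = (real_of_int (F K) + 1) / real b ^ K - x"
    have "e > 0"
      using upper[of K] by (simp add: e_def add_divide_distrib)
    then have "\<forall>\<^sub>F N in sequentially. 1 / real b ^ N < e"
      using lim0 by (simp add: order_tendstoD(2))
    then obtain N where N: "\<And>n. n \<ge> N \<Longrightarrow> 1 / real b ^ n < e"
      by (auto simp: eventually_sequentially)
    have "(real_of_int (F (K + N)) + 1) / real b ^ (K + N) = (real_of_int (F K) + 1) / real b ^ K"
      using b by (simp add: shift power_add)
    then have "e \<le> 1 / real b ^ (K + N)"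
      using lower[of "K + N"] by (simp add: e_def add_divide_distrib)
    with N[of "K + N"] show False by simp
  qed
qed

section \<open>The criterion and the component-by-component algorithm\<close>

definition eta :: "nat \<Rightarrow> nat \<Rightarrow> real" where
  "eta b \<xi> = (if \<xi> = 0 then real b - 1 else - 1)"

definition B_factor ::
  "(nat \<Rightarrow> real) \<Rightarrow> nat \<Rightarrow> nat \<Rightarrow> (nat \<Rightarrow> 'p::prime_card mod_ring poly) \<Rightarrow> 'p mod_ring poly \<Rightarrow>
   nat \<Rightarrow> nat \<Rightarrow> nat \<Rightarrow> real" where
  "B_factor u m d q p n j h =
     (let b = CARD('p) in
      \<Prod>i = 1..m. (1 + eta b (badic_digit b (lattice_coord m p (q (d * (j - 1) + h)) n) i)
                        / real b powr (real (d * (i - 1) + h) + a_seq b u j)))"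

text \<open>Only \<open>q 1, \<dots>, q \<tau>\<close> enter the definition.\<close>

definition B_crit ::
  "(nat \<Rightarrow> real) \<Rightarrow> nat \<Rightarrow> nat \<Rightarrow> nat \<Rightarrow> (nat \<Rightarrow> 'p::prime_card mod_ring poly) \<Rightarrow>
   'p mod_ring poly \<Rightarrow> real" where
  "B_crit u m d \<tau> q p =
     (let b = CARD('p); \<beta> = nat \<lceil>real \<tau> / real d\<rceil> in
      - 1 + 1 / real b ^ m *
        (\<Sum>n<b ^ m.
           (\<Prod>j = 1..\<beta> - 1. \<Prod>h = 1..d. B_factor u m d q p n j h) *
           (\<Prod>h = 1..\<tau> - d * (\<beta> - 1). B_factor u m d q p n \<beta> h)))"

definition R_set :: "nat \<Rightarrow> 'p::prime_card mod_ring poly set" where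
  "R_set m = {q. degree q < m \<and> q \<noteq> 0}"

definition cbc_constructed ::
  "(nat \<Rightarrow> real) \<Rightarrow> nat \<Rightarrow> nat \<Rightarrow> nat \<Rightarrow> 'p::prime_card mod_ring poly \<Rightarrow>
   (nat \<Rightarrow> 'p mod_ring poly) \<Rightarrow> bool" where
  "cbc_constructed u m s d p q \<longleftrightarrow>
     q 1 = 1 \<and>
     (\<forall>\<tau>\<in>{2..d * s}.
        is_arg_min (\<lambda>r. B_crit u m d \<tau> (q(\<tau> := r)) p) (\<lambda>r. r \<in> R_set m) (q \<tau>))"

end

theory Submission
  imports Defs
begin

text \<open>
  Write \<open>1 + \<eta>(\<xi>) w = \<Sum>\<^sub>\<kappa> \<chi>(\<kappa> \<xi>) w\<^sub>\<kappa>\<close> with an additive character \<open>\<chi>\<close>, \<open>w\<^sub>0 = 1\<close> and \<open>w\<^sub>\<kappa> = w\<close> for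
  \<open>\<kappa> \<noteq> 0\<close>. Orthogonality of characters turns the criterion into the sum of the positive weights
  \<open>b^(-\<mu>)\<close> over the nonzero frequencies in the dual net. Adding the component \<open>q\<^sub>\<tau>\<close> adds the dual
  frequencies whose \<open>\<tau>\<close>-th part is nonzero; since \<open>p\<close> is irreducible, such a frequency is dual
  for at most one choice of \<open>q\<^sub>\<tau>\<close>. The minimising choice is therefore at most as bad as the average over
  all \<open>b^m - 1\<close> choices, also after applying \<open>\<phi>\<close>, which is monotone and (up to \<open>\<phi> 0\<close>)
  subadditive. Induction on \<open>\<tau>\<close> bounds \<open>\<phi>\<close> of the criterion, and \<open>\<phi>\<close> can be
  inverted because it is strictly increasing and the bound lies in its range.
\<close>

section \<open>Concave functions on the half-line\<close>

text \<open>Both \<open>x\<close> and \<open>y\<close> are convex combinations of \<open>0\<close>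
  and \<open>x + y\<close>, with complementary weights. Adding the two concavity inequalities gives
  \<open>f 0 + f (x + y) \<le> f x + f y\<close>.\<close>

lemma concave_on_subadditive:
  fixes f :: "real \<Rightarrow> real"
  assumes f: "concave_on {0..} f" and x: "0 \<le> x" and y: "0 \<le> y"
  shows "f (x + y) - f 0 \<le> (f x - f 0) + (f y - f 0)"
proof (cases "x + y = 0")
  case True
  with x y have "x = 0" "y = 0" by auto
  then show ?thesis by simp
next
  case False
  define t where "t = y / (x + y)"
  have t: "0 \<le> t" "t \<le> 1"
    using x y False by (auto simp: t_def divide_le_eq_1)
  have tx: "(1 - t) * (x + y) = x" and ty: "t * (x + y) = y"
    using False by (simp_all add: t_def field_simps)
  have "(1 - t) * f 0 + t * f (x + y) \<le> f ((1 - t) *\<^sub>R 0 + t *\<^sub>R (x + y))"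
    using concave_onD[OF f t, of 0 "x + y"] x y by simp
  moreover have "(1 - t) * f (x + y) + t * f 0 \<le> f ((1 - t) *\<^sub>R (x + y) + t *\<^sub>R 0)"
    using concave_onD[OF f t, of "x + y" 0] x y by simp
  moreover have "(1 - t) *\<^sub>R 0 + t *\<^sub>R (x + y) = y" "(1 - t) *\<^sub>R (x + y) + t *\<^sub>R 0 = x"
    using tx ty by simp_all
  ultimately have "(1 - t) * f 0 + t * f (x + y) \<le> f y" "(1 - t) * f (x + y) + t * f 0 \<le> f x"
    by simp_all
  then show ?thesis
    by (simp add: algebra_simps)
qed

lemma concave_on_sum_le:
  fixes f :: "real \<Rightarrow> real"
  assumes f: "concave_on {0..} f" and "finite A" and "\<And>a. a \<in> A \<Longrightarrow> 0 \<le> g a"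
  shows "f (\<Sum>a\<in>A. g a) - f 0 \<le> (\<Sum>a\<in>A. f (g a) - f 0)"
  using assms(2,3)
proof (induction A rule: finite_induct)
  case (insert a A)
  have "f (g a + sum g A) - f 0 \<le> (f (g a) - f 0) + (f (sum g A) - f 0)"
    using insert.prems by (intro concave_on_subadditive[OF f] sum_nonneg) auto
  with insert show ?case by fastforce
qed simp

text \<open>If \<open>f\<close> were flat between \<open>x\<close> and \<open>y\<close>, concavity
  would keep it below \<open>f y\<close> from there on, because \<open>y\<close> lies between
  \<open>x\<close> and every later \<open>z\<close>. This contradicts unboundedness.\<close>

lemma concave_mono_unbounded_strict:
  fixes f :: "real \<Rightarrow> real"
  assumes f: "concave_on {0..} f" "mono_on {0..} f" "\<not> bdd_above (f ` {0..})"
    and xy: "0 \<le> x" "x < y"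
  shows "f x < f y"
proof (rule ccontr)
  assume "\<not> f x < f y"
  then have eq: "f y \<le> f x" by simp
  have "f z \<le> f y" if "0 \<le> z" for z
  proof (cases "z \<le> y")
    case True
    with that xy show ?thesis by (intro mono_onD[OF f(2)]) auto
  next
    case False
    define t where "t = (y - x) / (z - x)"
    have t: "0 < t" "t \<le> 1"
      using xy False by (auto simp: t_def)
    have "t * (z - x) = y - x"
      using xy False by (simp add: t_def)
    then have yt: "(1 - t) * x + t * z = y"
      by (simp add: algebra_simps)
    have "(1 - t) * f x + t * f z \<le> f y"
      using concave_onD[OF f(1), of t x z] t xy that by (simp add: yt)
    moreover have "(1 - t) * f y \<le> (1 - t) * f x"
      using eq t by (intro mult_left_mono) auto
    ultimately have "t * f z \<le> t * f y"
      by (simp add: algebra_simps)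
    with t show ?thesis by simp
  qed
  then have "bdd_above (f ` {0..})"
    by (intro bdd_aboveI[of _ "f y"]) auto
  with f(3) show False by simp
qed

text \<open>A concave function may jump at \<open>0\<close>, so \<open>f 0 \<le> y\<close> would not suffice here.\<close>
lemma concave_mono_unbounded_attains:
  fixes f :: "real \<Rightarrow> real"
  assumes f: "concave_on {0..} f" "\<not> bdd_above (f ` {0..})" "mono_on {0..} f"
    and x: "0 < x" "f x \<le> y"
  shows "y \<in> f ` {0..}"
proof -
  obtain z where z: "0 \<le> z" "y < f z"
    using f(2) by (auto simp: bdd_above_def not_le)
  have xz: "x \<le> z"
  proof (rule ccontr)
    assume "\<not> x \<le> z"
    then have "f z \<le> f x" using z x by (intro mono_onD[OF f(3)]) auto
    with x z show False by simp
  qed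
  have "convex_on {0<..} (\<lambda>x. - f x)"
    using f(1) unfolding concave_on_def by (rule convex_on_subset) auto
  then have "continuous_on {0<..} (\<lambda>x. - f x)"
    by (intro convex_on_continuous) auto
  then have "continuous_on {x..z} (\<lambda>x. - f x)"
    by (rule continuous_on_subset) (use x in auto)
  then have "continuous_on {x..z} f"
    using continuous_on_minus by fastforce
  then obtain v where "x \<le> v" "f v = y"
    using IVT'[of f x y z] x z xz by auto
  with x show ?thesis by force
qed

section \<open>Additive characters\<close>

definition chi :: "'p::prime_card mod_ring \<Rightarrow> complex" where
  "chi x = cis (2 * pi * of_int (to_int_mod_ring x) / real CARD('p))"

text \<open>Removing multiples of \<open>b\<close> changes the angle by multiples of
  \<open>2 * pi\<close>. Hence \<open>chi\<close> may be evaluated at any integer representative,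
  which makes it additive.\<close>

lemma cis_mod:
  fixes b :: nat
  assumes "b > 0"
  shows "cis (2 * pi * of_int (n mod int b) / real b) = cis (2 * pi * of_int n / real b)"
proof -
  have "2 * pi * of_int n / real b = 2 * pi * of_int (n mod int b) / real b + 2 * pi * of_int (n div int b)"
  proof -
    have "real_of_int n = of_int (n div int b * int b + n mod int b)"
      by (simp only: div_mult_mod_eq)
    then have "real_of_int n = of_int (n div int b) * real b + of_int (n mod int b)"
      by (simp only: of_int_add of_int_mult of_int_of_nat_eq)
    then show ?thesis using assms by (simp add: field_simps)
  qed
  then show ?thesis by (simp flip: cis_mult)
qed

lemma chi_add: "chi (x + y) = chi x * chi y"
  by (simp add: chi_def to_int_mod_ring_add cis_mod cis_mult add_divide_distrib distrib_left)

lemma chi_0 [simp]: "chi 0 = 1"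
  by (simp add: chi_def)

lemma chi_sum: "chi (\<Sum>x\<in>A. f x) = (\<Prod>x\<in>A. chi (f x))"
  by (induction A rule: infinite_finite_induct) (simp_all add: chi_add)

lemma to_int_mod_ring_bounds:
  "0 \<le> to_int_mod_ring (x :: 'p::finite mod_ring)" "to_int_mod_ring (x :: 'p mod_ring) < int CARD('p)"
  using range_to_int_mod_ring[where 'a = 'p] by (metis atLeastLessThan_iff rangeI)+

lemma chi_eq_1_iff: "chi (x :: 'p::prime_card mod_ring) = 1 \<longleftrightarrow> x = 0"
proof
  assume "chi x = 1"
  then have "cos (2 * pi * of_int (to_int_mod_ring x) / real CARD('p)) = 1"
    by (simp add: chi_def complex_eq_iff)
  then obtain n :: int where
    "2 * pi * of_int (to_int_mod_ring x) / real CARD('p) = of_int n * 2 * pi"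
    by (auto simp: cos_one_2pi_int)
  then have "of_int (to_int_mod_ring x) = (of_int (n * int CARD('p)) :: real)"
    by (simp add: field_simps)
  then have "to_int_mod_ring x = n * int CARD('p)"
    by (simp only: of_int_eq_iff)
  then have "to_int_mod_ring x mod int CARD('p) = 0" by simp
  then have "to_int_mod_ring x = 0"
    using to_int_mod_ring_bounds[of x] by simp
  then show "x = 0" by simp
qed simp

text \<open>Orthogonality: if \<open>L v \<noteq> 0\<close>, translating the sum by \<open>v\<close>
  multiplies it by \<open>chi (L v) \<noteq> 1\<close>, so it vanishes. Used with \<open>V\<close>
  the whole field and with \<open>V = polys m\<close>.\<close>

lemma sum_chi_additive:
  fixes L :: "'a::ab_group_add \<Rightarrow> 'p::prime_card mod_ring"
  assumes V: "finite V" "\<And>x y. x \<in> V \<Longrightarrow> y \<in> V \<Longrightarrow> x + y \<in> V" "\<And>x. x \<in> V \<Longrightarrow> - x \<in> V"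
    and L: "\<And>x y. L (x + y) = L x + L y"
  shows "(\<Sum>x\<in>V. chi (L x)) = (if \<forall>x\<in>V. L x = 0 then of_nat (card V) else 0)"
proof (cases "\<forall>x\<in>V. L x = 0")
  case False
  then obtain v where v: "v \<in> V" "L v \<noteq> 0" by blast
  have "(\<Sum>x\<in>V. chi (L x)) = (\<Sum>x\<in>V. chi (L (v + x)))"
  proof (rule sum.reindex_bij_witness[of _ "\<lambda>x. v + x" "\<lambda>x. - v + x"])
    show "- v + a \<in> V" if "a \<in> V" for a by (intro V that v)
  qed (use V v in \<open>auto simp: algebra_simps\<close>)
  also have "\<dots> = chi (L v) * (\<Sum>x\<in>V. chi (L x))"
    by (simp add: L chi_add sum_distrib_left)
  finally have "(1 - chi (L v)) * (\<Sum>x\<in>V. chi (L x)) = 0"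
    by (simp add: algebra_simps)
  with v have "(\<Sum>x\<in>V. chi (L x)) = 0" by (simp add: chi_eq_1_iff)
  with False show ?thesis by auto
qed simp

text \<open>By orthogonality the characters with nonzero \<open>\<kappa>\<close> sum to
  \<open>b - 1\<close> at \<open>x = 0\<close> and to \<open>-1\<close> elsewhere, which is exactly
  \<open>eta\<close>.\<close>

lemma eta_eq_sum_chi:
  fixes x :: "'p::prime_card mod_ring"
  shows "complex_of_real (1 + eta CARD('p) (nat (to_int_mod_ring x)) * w)
    = (\<Sum>\<kappa>\<in>UNIV. chi (\<kappa> * x) * of_real (if \<kappa> = 0 then 1 else w))"
proof -
  have "(\<Sum>\<kappa>\<in>UNIV. chi (\<kappa> * x)) = (if \<forall>\<kappa>\<in>UNIV. \<kappa> * x = 0 then of_nat (card (UNIV :: 'p mod_ring set)) else 0)"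
    by (rule sum_chi_additive) (auto simp: algebra_simps)
  also have "\<dots> = (if x = 0 then of_nat CARD('p) else 0)"
    by (auto dest: bspec[of _ _ 1])
  finally have "(\<Sum>\<kappa>\<in>UNIV-{0}. chi (\<kappa> * x)) = (if x = 0 then of_nat CARD('p) else 0) - 1"
    by (subst (asm) sum.remove[of _ 0]) (auto simp: eq_diff_eq add.commute)
  then have "(\<Sum>\<kappa>\<in>UNIV-{0}. chi (\<kappa> * x) * of_real (if \<kappa> = 0 then 1 else w))
      = ((if x = 0 then of_nat CARD('p) else 0) - 1) * of_real w"
    by (simp flip: sum_distrib_right)
  moreover have "nat (to_int_mod_ring x) = 0 \<longleftrightarrow> x = 0"
    using to_int_mod_ring_bounds(1)[of x] by auto
  ultimately show ?thesis
    by (subst sum.remove[of _ 0]) (auto simp: eta_def)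
qed

section \<open>Laurent coefficients and digits\<close>

lemma laurent_of_poly_pCons:
  "laurent_of_poly (pCons a f) = fls_const a + fls_X_inv * laurent_of_poly f"
  by (simp add: laurent_of_poly_def Polynomial.map_poly_pCons)

lemma laurent_of_poly_0 [simp]: "laurent_of_poly 0 = 0"
  by (simp add: laurent_of_poly_def)

text \<open>The index is minus the exponent of x, so the coefficient of \<open>x^i\<close> sits at
  \<open>-i\<close>. Nothing sits at positive indices: a polynomial has no fractional part.\<close>

lemma laurent_of_poly_nth:
  "fls_nth (laurent_of_poly f) k = (if k \<le> 0 then poly.coeff f (nat (- k)) else 0)"
proof (induction f arbitrary: k)
  case (pCons a f)
  have "nat (- k) = Suc (nat (- (k + 1)))" if "k < 0"
    using that by simp
  with pCons.IH show ?case
    by (auto simp: laurent_of_poly_pCons fls_X_inv_times_conv_shift coeff_pCons split: nat.splits)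
qed simp

lemma laurent_of_poly_add: "laurent_of_poly (f + g) = laurent_of_poly f + laurent_of_poly g"
  by (rule fls_eqI) (simp add: laurent_of_poly_nth)

lemma laurent_of_poly_mult: "laurent_of_poly (f * g) = laurent_of_poly f * laurent_of_poly g"
proof (induction f)
  case (pCons a f)
  have "laurent_of_poly (Polynomial.smult a g) = fls_const a * laurent_of_poly g"
    by (rule fls_eqI) (simp add: laurent_of_poly_nth)
  moreover have "laurent_of_poly (pCons 0 (f * g)) = fls_X_inv * laurent_of_poly (f * g)"
    by (simp add: laurent_of_poly_pCons)
  ultimately show ?case
    by (simp add: laurent_of_poly_add laurent_of_poly_pCons pCons.IH algebra_simps)
qed simp

lemma laurent_of_poly_eq_0_iff [simp]: "laurent_of_poly f = 0 \<longleftrightarrow> f = 0"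
proof
  assume "laurent_of_poly f = 0"
  then have "poly.coeff f i = 0" for i
    using laurent_of_poly_nth[of f "- int i"] by simp
  then show "f = 0" by (simp add: poly_eq_iff)
qed simp

lemma laurent_of_poly_subdegree:
  assumes "f \<noteq> 0"
  shows "fls_subdegree (laurent_of_poly f) = - int (degree f)"
  using assms
  by (intro fls_subdegree_eqI) (auto simp: laurent_of_poly_nth coeff_eq_0)

text \<open>For \<open>i \<ge> 1\<close> these are the digits of the fractional part of
  \<open>f / p\<close>, kept as field elements so that they are additive in
  \<open>f\<close>.\<close>

definition lcoeff :: "'a::field poly \<Rightarrow> nat \<Rightarrow> 'a poly \<Rightarrow> 'a" where
  "lcoeff p i f = fls_nth (laurent_of_poly f / laurent_of_poly p) (int i)"

lemma lcoeff_add: "lcoeff p i (f + g) = lcoeff p i f + lcoeff p i g"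
  by (simp add: lcoeff_def laurent_of_poly_add add_divide_distrib)

lemma lcoeff_0 [simp]: "lcoeff p i 0 = 0"
  by (simp add: lcoeff_def)

lemma lcoeff_diff: "lcoeff p i (f - g) = lcoeff p i f - lcoeff p i g"
  using lcoeff_add[of p i "f - g" g] by simp

text \<open>\<open>f / p\<close> and \<open>(f mod p) / p\<close> differ by the polynomial
  \<open>f div p\<close>, which only has coefficients at indices \<open>\<le> 0\<close>.\<close>

lemma lcoeff_mod:
  assumes "p \<noteq> 0" "i \<ge> 1"
  shows "lcoeff p i (f mod p) = lcoeff p i f"
proof -
  have "lcoeff p i (p * (f div p)) = 0"
    using assms by (simp add: lcoeff_def laurent_of_poly_mult laurent_of_poly_nth)
  then show ?thesis
    using lcoeff_add[of p i "p * (f div p)" "f mod p"] by simp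
qed

text \<open>For nonzero \<open>f\<close> the leading coefficient of \<open>f / p\<close> sits at
  index \<open>degree p - degree f\<close>, which lies in the range tested.\<close>

lemma lcoeff_eq_0_imp:
  assumes f: "degree f < degree p" and z: "\<And>i. i \<in> {1..degree p} \<Longrightarrow> lcoeff p i f = 0"
  shows "f = 0"
proof (rule ccontr)
  assume "f \<noteq> 0"
  have p: "p \<noteq> 0" using f by auto
  define F where "F = laurent_of_poly f / laurent_of_poly p"
  have F: "F * laurent_of_poly p = laurent_of_poly f"
    using p by (simp add: F_def)
  with \<open>f \<noteq> 0\<close> have "F \<noteq> 0" by auto
  have "fls_subdegree F - int (degree p) = - int (degree f)"
    using arg_cong[OF F, of fls_subdegree] p \<open>f \<noteq> 0\<close> \<open>F \<noteq> 0\<close>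
    by (simp add: laurent_of_poly_subdegree)
  then have "fls_subdegree F = int (degree p - degree f)"
    using f by simp
  then have "fls_nth F (int (degree p - degree f)) \<noteq> 0"
    using \<open>F \<noteq> 0\<close> nth_fls_subdegree_nonzero by metis
  moreover have "lcoeff p (degree p - degree f) f = 0"
    using f by (intro z) auto
  ultimately show False
    by (simp add: lcoeff_def F_def)
qed

section \<open>Polynomials of degree below \<open>m\<close> and their enumeration by the integers
  below \<open>b^m\<close>\<close>

definition polys :: "nat \<Rightarrow> 'a::zero poly set" where
  "polys m = {f. degree f < m}"

lemma nat_digits_unique:
  fixes b :: nat
  assumes "n < b ^ m" "n' < b ^ m"
    and "\<And>i. i < m \<Longrightarrow> n div b ^ i mod b = n' div b ^ i mod b"
  shows "n = n'"
proof -
  have "n mod b ^ k = n' mod b ^ k" if "k \<le> m" for k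
    using that
  proof (induction k)
    case (Suc k)
    have "x mod b ^ Suc k = b ^ k * (x div b ^ k mod b) + x mod b ^ k" for x
      by (metis mod_mult2_eq power_Suc2)
    with Suc assms(3)[of k] show ?case by simp
  qed simp
  from this[of m] assms(1,2) show ?thesis by simp
qed

lemma to_int_mod_ring_of_nat:
  "n < CARD('p) \<Longrightarrow> to_int_mod_ring (of_nat n :: 'p::nontriv mod_ring) = int n"
  by (simp add: of_nat_of_int_mod_ring)

lemma of_nat_mod_ring_inj:
  assumes "x < CARD('p)" "y < CARD('p)" "(of_nat x :: 'p::nontriv mod_ring) = of_nat y"
  shows "x = y"
  using to_int_mod_ring_of_nat[OF assms(1)] to_int_mod_ring_of_nat[OF assms(2)] assms(3)
  by (metis of_nat_eq_iff)

lemma coeff_poly_of_nat: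
  "poly.coeff (poly_of_nat m n :: 'p::prime_card mod_ring poly) i
    = (if i < m then of_nat (n div CARD('p) ^ i mod CARD('p)) else 0)"
  by (simp add: poly_of_nat_def Polynomial.coeff_sum)

lemma card_polys_le:
  "finite (polys m :: 'a::{finite,zero} poly set)" (is ?fin)
  "card (polys m :: 'a poly set) \<le> CARD('a) ^ m" (is ?card)
proof -
  have inj: "inj_on (\<lambda>f. restrict (poly.coeff f) {..<m}) (polys m :: 'a poly set)"
  proof (rule inj_onI)
    fix f g :: "'a poly"
    assume fg: "f \<in> polys m" "g \<in> polys m" "restrict (poly.coeff f) {..<m} = restrict (poly.coeff g) {..<m}"
    have "poly.coeff f i = poly.coeff g i" for i
    proof (cases "i < m")
      case True
      then show ?thesis using fun_cong[OF fg(3), of i] by simp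
    next
      case False
      with fg(1,2) show ?thesis by (simp add: polys_def coeff_eq_0)
    qed
    then show "f = g" by (simp add: poly_eq_iff)
  qed
  have sub: "(\<lambda>f. restrict (poly.coeff f) {..<m}) ` (polys m :: 'a poly set) \<subseteq> {..<m} \<rightarrow>\<^sub>E (UNIV :: 'a set)"
    by (intro image_subsetI) (simp only: restrict_PiE_iff, simp)
  have fin: "finite ({..<m} \<rightarrow>\<^sub>E (UNIV :: 'a set))"
    by (intro finite_PiE) auto
  show ?fin
    using inj_on_finite[OF inj sub fin] .
  show ?card
    using card_inj_on_le[OF inj sub fin] by (simp add: card_PiE)
qed

text \<open>The digits of \<open>n\<close> can be read off the coefficients, so the map is
  injective; the bound of \<open>card_polys_le\<close> then forces surjectivity. For
  \<open>m = 0\<close> it would fail, since \<open>polys 0\<close> is empty.\<close>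

lemma bij_betw_poly_of_nat:
  assumes "m \<ge> 1"
  shows "bij_betw (poly_of_nat m) {..<CARD('p::prime_card) ^ m} (polys m :: 'p mod_ring poly set)"
proof -
  have inj: "inj_on (poly_of_nat m :: nat \<Rightarrow> 'p mod_ring poly) {..<CARD('p) ^ m}"
  proof (rule inj_onI)
    fix x y :: nat
    assume xy: "x \<in> {..<CARD('p) ^ m}" "y \<in> {..<CARD('p) ^ m}"
      "(poly_of_nat m x :: 'p mod_ring poly) = poly_of_nat m y"
    show "x = y"
    proof (rule nat_digits_unique)
      fix i assume "i < m"
      then have "(of_nat (x div CARD('p) ^ i mod CARD('p)) :: 'p mod_ring)
          = of_nat (y div CARD('p) ^ i mod CARD('p))"
        using arg_cong[OF xy(3), of "\<lambda>f. poly.coeff f i"] unfolding coeff_poly_of_nat by simp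
      then show "x div CARD('p) ^ i mod CARD('p) = y div CARD('p) ^ i mod CARD('p)"
        by (rule of_nat_mod_ring_inj[rotated 2]) simp_all
    qed (use xy in auto)
  qed
  have "degree (poly_of_nat m x :: 'p mod_ring poly) \<le> m - 1" for x
    by (rule degree_le) (use assms in \<open>auto simp: coeff_poly_of_nat\<close>)
  then have sub: "(poly_of_nat m :: nat \<Rightarrow> 'p mod_ring poly) ` {..<CARD('p) ^ m} \<subseteq> polys m"
    using assms by (fastforce simp: polys_def intro: le_less_trans)
  have "(poly_of_nat m :: nat \<Rightarrow> 'p mod_ring poly) ` {..<CARD('p) ^ m} = polys m"
    by (rule card_seteq[OF card_polys_le(1) sub])
      (use card_polys_le(2)[where 'a = "'p mod_ring", of m] in \<open>simp add: card_image[OF inj]\<close>)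
  with inj show ?thesis by (simp add: bij_betw_def)
qed

lemma card_polys: "m \<ge> 1 \<Longrightarrow> card (polys m :: 'p::prime_card mod_ring poly set) = CARD('p) ^ m"
  using bij_betw_same_card[OF bij_betw_poly_of_nat[where 'p = 'p]] by simp

text \<open>If all \<open>m\<close> coefficients of \<open>f * g / p\<close> vanish, then
  \<open>p\<close> divides \<open>f * g\<close> and hence \<open>f\<close>, being prime and of
  larger degree than \<open>g\<close>. So the additive map from \<open>f\<close> to these
  coefficients is injective, and both sides have \<open>b^m\<close> elements.\<close>

lemma lcoeff_mult_surj:
  fixes p g :: "'p::prime_card mod_ring poly"
  assumes p: "irreducible p" "degree p = m" and m: "m \<ge> 1"
    and g: "degree g < m" "g \<noteq> 0"
  obtains f where "f \<in> polys m" "\<And>i. i \<in> {1..m} \<Longrightarrow> lcoeff p i (f * g) = t i"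
proof -
  define \<Phi> where "\<Phi> f = (\<lambda>i\<in>{1..m}. lcoeff p i (f * g))" for f
  have p0: "p \<noteq> 0" using p m by auto
  have inj: "inj_on \<Phi> (polys m)"
  proof (rule inj_onI)
    fix f f' assume ff: "f \<in> polys m" "f' \<in> polys m" "\<Phi> f = \<Phi> f'"
    have "lcoeff p i ((f - f') * g mod p) = 0" if "i \<in> {1..m}" for i
      using fun_cong[OF ff(3), of i] that
      by (simp add: \<Phi>_def lcoeff_mod[OF p0] left_diff_distrib lcoeff_diff)
    then have "(f - f') * g mod p = 0"
      using p m degree_mod_less[OF p0, of "(f - f') * g"] by (intro lcoeff_eq_0_imp[of _ p]) auto
    then have "p dvd (f - f') * g" by auto
    then have "p dvd f - f' \<or> p dvd g"
      using field_poly_irreducible_imp_prime[OF p(1)] by (simp add: prime_elem_dvd_mult_iff)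
    moreover have "\<not> p dvd g"
      using g p dvd_imp_degree_le[of p g] by auto
    moreover have "degree (f - f') < m"
      using ff degree_diff_le_max[of f f'] by (auto simp: polys_def)
    ultimately show "f = f'"
      using p dvd_imp_degree_le[of p "f - f'"] by auto
  qed
  have fin: "finite ({1..m} \<rightarrow>\<^sub>E (UNIV :: 'p mod_ring set))"
    by (intro finite_PiE) auto
  have "card (\<Phi> ` polys m) = CARD('p) ^ m"
    using card_image[OF inj] card_polys[OF m] by simp
  moreover have "\<Phi> ` polys m \<subseteq> {1..m} \<rightarrow>\<^sub>E UNIV"
    by (auto simp: \<Phi>_def)
  ultimately have "\<Phi> ` polys m = {1..m} \<rightarrow>\<^sub>E UNIV"
    by (intro card_subset_eq[OF fin]) (simp_all add: card_PiE)
  then have "(\<lambda>i\<in>{1..m}. t i) \<in> \<Phi> ` polys m" by auto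
  then obtain f where f: "f \<in> polys m" "(\<lambda>i\<in>{1..m}. t i) = \<Phi> f" by blast
  show ?thesis
  proof (rule that[OF f(1)])
    show "lcoeff p i (f * g) = t i" if "i \<in> {1..m}" for i
      using fun_cong[OF f(2), of i] that by (simp add: \<Phi>_def)
  qed
qed

text \<open>Multiplying by \<open>b^i\<close> gives an integer \<open>Z\<close> congruent to
  \<open>c i\<close> modulo \<open>b\<close>, plus a tail \<open>T\<close>. The tail is finite, so
  the geometric bound keeps it strictly below 1 even if all later digits are
  \<open>b - 1\<close>.\<close>

lemma badic_digit_sum:
  fixes b :: nat and c :: "nat \<Rightarrow> int"
  assumes b: "b \<ge> 2" and c: "\<And>l. 0 \<le> c l" "\<And>l. c l < int b" and i: "i \<in> {1..m}"
  shows "badic_digit b (\<Sum>l = 1..m. of_int (c l) / real b ^ l) i = nat (c i)"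
proof -
  define x where "x = (\<Sum>l = 1..m. of_int (c l) / real b ^ l)"
  define Z where "Z = (\<Sum>l = 1..i. c l * int b ^ (i - l))"
  define T where "T = (\<Sum>l = i + 1..m. of_int (c l) / real b ^ (l - i))"
  have "{1..m} = {1..i} \<union> {i+1..m}" using i by auto
  then have "x = (\<Sum>l = 1..i. of_int (c l) / real b ^ l) + (\<Sum>l = i+1..m. of_int (c l) / real b ^ l)"
    unfolding x_def by (simp add: sum.union_disjoint)
  moreover have "(\<Sum>l = 1..i. of_int (c l) / real b ^ l) * real b ^ i = of_int Z"
    unfolding Z_def sum_distrib_right of_int_sum
  proof (intro sum.cong refl)
    fix l assume "l \<in> {1..i}"
    then have "real b ^ i = real b ^ l * real b ^ (i - l)"
      by (simp flip: power_add)
    then show "of_int (c l) / real b ^ l * real b ^ i = of_int (c l * int b ^ (i - l))"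
      using b by simp
  qed
  moreover have "(\<Sum>l = i+1..m. of_int (c l) / real b ^ l) * real b ^ i = T"
    unfolding T_def sum_distrib_right
  proof (intro sum.cong refl)
    fix l assume "l \<in> {i + 1..m}"
    then have "real b ^ l = real b ^ i * real b ^ (l - i)"
      by (simp flip: power_add)
    then show "of_int (c l) / real b ^ l * real b ^ i = of_int (c l) / real b ^ (l - i)"
      using b by simp
  qed
  ultimately have xZ: "x * real b ^ i = of_int Z + T"
    by (simp add: distrib_right)
  have geo: "(\<Sum>l = i + 1..k. (real b - 1) / real b ^ (l - i)) = 1 - 1 / real b ^ (k - i)" if "i \<le> k" for k
    using that
  proof (induction k rule: dec_induct)
    case (step k)
    have "(real b - 1) / real b ^ Suc (k - i) = 1 / real b ^ (k - i) - 1 / real b ^ Suc (k - i)"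
      using b by (simp add: field_simps)
    with step show ?case by (simp add: Suc_diff_le)
  qed simp
  have "T \<le> (\<Sum>l = i + 1..m. (real b - 1) / real b ^ (l - i))"
    unfolding T_def
  proof (intro sum_mono divide_right_mono)
    show "real_of_int (c l) \<le> real b - 1" for l
      using c(2)[of l] by linarith
  qed simp
  also have "\<dots> = 1 - 1 / real b ^ (m - i)"
    using geo i by simp
  also have "\<dots> < 1"
    using b by simp
  finally have "T < 1" .
  moreover have "0 \<le> T"
    unfolding T_def by (intro sum_nonneg divide_nonneg_nonneg) (use c in auto)
  ultimately have "\<lfloor>x * real b ^ i\<rfloor> = Z"
    unfolding xZ by (simp add: floor_eq_iff)
  moreover have "Z mod int b = c i"
  proof -
    obtain k where k: "i = Suc k" using i by (cases i) auto
    have "Z = c i + (\<Sum>l = 1..k. c l * int b ^ (Suc k - l))"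
      by (simp add: Z_def k)
    also have "(\<Sum>l = 1..k. c l * int b ^ (Suc k - l)) = int b * (\<Sum>l = 1..k. c l * int b ^ (k - l))"
      unfolding sum_distrib_left by (intro sum.cong refl) (auto simp: Suc_diff_le)
    finally show ?thesis using c[of i] by simp
  qed
  ultimately show ?thesis
    by (simp add: badic_digit_def x_def)
qed

lemma badic_digit_lattice_coord:
  fixes p q :: "'p::prime_card mod_ring poly"
  assumes "i \<in> {1..m}"
  shows "badic_digit CARD('p) (lattice_coord m p q n) i
    = nat (to_int_mod_ring (lcoeff p i (poly_of_nat m n * q)))"
  unfolding lattice_coord_def v_trunc_def lcoeff_def
  using assms nontriv[where 'a = 'p]
  by (intro badic_digit_sum to_int_mod_ring_bounds) auto

section \<open>The dual net and the component-by-component induction\<close>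

text \<open>
  Frequencies are indexed by pairs \<open>(t, i)\<close> of a component \<open>t\<close> and a digit position \<open>i\<close>.
  All \<open>freqs m N \<tau>\<close> live on the full index set of \<open>N\<close> components, with zeros beyond the
  \<open>\<tau>\<close>-th, so that they are nested in \<open>\<tau>\<close>.
\<close>
definition idx :: "nat \<Rightarrow> nat \<Rightarrow> (nat \<times> nat) set" where
  "idx m N = {1..N} \<times> {1..m}"

definition freqs :: "nat \<Rightarrow> nat \<Rightarrow> nat \<Rightarrow> (nat \<times> nat \<Rightarrow> 'a::zero) set" where
  "freqs m N \<tau> = (\<Pi>\<^sub>E x\<in>idx m N. if fst x \<le> \<tau> then UNIV else {0})"

text \<open>The frequencies orthogonal to the digit vectors of all lattice points: \<open>f\<close>
  runs through the polynomials attached to the indices \<open>n < b^m\<close>.\<close>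

definition dual_net ::
  "nat \<Rightarrow> nat \<Rightarrow> 'a::field poly \<Rightarrow> (nat \<Rightarrow> 'a poly) \<Rightarrow> (nat \<times> nat \<Rightarrow> 'a) set" where
  "dual_net m N p q =
     {K. \<forall>f\<in>polys m. (\<Sum>x\<in>idx m N. K x * lcoeff p (snd x) (f * q (fst x))) = 0}"

definition freq_weight :: "nat \<Rightarrow> nat \<Rightarrow> (nat \<times> nat \<Rightarrow> real) \<Rightarrow> (nat \<times> nat \<Rightarrow> 'a::zero) \<Rightarrow> real" where
  "freq_weight m N w K = (\<Prod>x\<in>idx m N. if K x = 0 then 1 else w x)"

abbreviation zero_freq :: "nat \<Rightarrow> nat \<Rightarrow> nat \<times> nat \<Rightarrow> 'a::zero" where
  "zero_freq m N \<equiv> \<lambda>x\<in>idx m N. 0"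

lemma finite_idx [simp]: "finite (idx m N)"
  by (simp add: idx_def)

lemma finite_freqs [simp]: "finite (freqs m N \<tau> :: (nat \<times> nat \<Rightarrow> 'a::{zero,finite}) set)"
  unfolding freqs_def by (intro finite_PiE) auto

lemma freqs_mono: "\<sigma> \<le> \<tau> \<Longrightarrow> freqs m N \<sigma> \<subseteq> freqs m N \<tau>"
  unfolding freqs_def by (intro PiE_mono) auto

lemma zero_freq_in_freqs: "zero_freq m N \<in> freqs m N \<tau>"
  by (simp add: freqs_def restrict_PiE_iff)

lemma freqs_0: "freqs m N 0 = {zero_freq m N}"
proof -
  have "freqs m N 0 = idx m N \<rightarrow>\<^sub>E {0}"
    unfolding freqs_def by (intro PiE_cong) (auto simp: idx_def)
  then show ?thesis by simp
qed

lemma freqs_eq_0: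
  assumes "K \<in> freqs m N \<tau>" "x \<in> idx m N" "\<tau> < fst x"
  shows "K x = 0"
  using PiE_mem[OF assms(1)[unfolded freqs_def] assms(2)] assms(3) by simp

lemma freqs_dest:
  assumes "K \<in> freqs m N (Suc \<tau>)" "K \<notin> freqs m N \<tau>"
  obtains i where "(Suc \<tau>, i) \<in> idx m N" "K (Suc \<tau>, i) \<noteq> 0"
proof -
  have "\<not> (\<forall>x\<in>idx m N. K x \<in> (if fst x \<le> \<tau> then UNIV else {0}))"
    using assms unfolding freqs_def PiE_iff by blast
  then obtain x where x: "x \<in> idx m N" "\<tau> < fst x" "K x \<noteq> 0"
    by (auto split: if_splits)
  with freqs_eq_0[OF assms(1) x(1)] have "fst x = Suc \<tau>"
    by fastforce
  with x show ?thesis by (intro that[of "snd x"]) (metis prod.collapse)+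
qed

lemma zero_freq_in_dual_net: "zero_freq m N \<in> dual_net m N p q"
  by (simp add: dual_net_def)

lemma freq_weight_zero [simp]: "freq_weight m N w (zero_freq m N) = 1"
  by (simp add: freq_weight_def)

lemma freq_weight_pos: "(\<And>x. 0 < w x) \<Longrightarrow> 0 < freq_weight m N w K"
  unfolding freq_weight_def by (intro prod_pos) auto

text \<open>\<open>K\<close> vanishes on the components where \<open>q\<close> and \<open>q'\<close>
  may differ. Hence choosing a later component never changes which earlier frequencies are
  dual.\<close>

lemma dual_net_cong:
  assumes "K \<in> freqs m N \<tau>" and "\<And>t. t \<le> \<tau> \<Longrightarrow> q t = q' t"
  shows "K \<in> dual_net m N p q \<longleftrightarrow> K \<in> dual_net m N p q'"
proof -
  have "(\<Sum>x\<in>idx m N. K x * lcoeff p (snd x) (f * q (fst x)))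
      = (\<Sum>x\<in>idx m N. K x * lcoeff p (snd x) (f * q' (fst x)))" for f
  proof (intro sum.cong refl)
    fix x assume "x \<in> idx m N"
    then show "K x * lcoeff p (snd x) (f * q (fst x)) = K x * lcoeff p (snd x) (f * q' (fst x))"
      using freqs_eq_0[OF assms(1)] assms(2)[of "fst x"] by (cases "fst x \<le> \<tau>") auto
  qed
  then show ?thesis by (simp add: dual_net_def)
qed

text \<open>Subtracting the two orthogonality relations leaves only component
  \<open>Suc \<tau>\<close>, paired with \<open>r - r'\<close>. A suitable \<open>f\<close> isolates
  a single nonzero digit of \<open>K\<close> there.\<close>

lemma dual_net_component_unique:
  fixes p :: "'p::prime_card mod_ring poly"
  assumes p: "irreducible p" "degree p = m" and m: "m \<ge> 1"
    and K: "K \<in> freqs m N (Suc \<tau>)" "K \<notin> freqs m N \<tau>"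
    and r: "r \<in> polys m" "r' \<in> polys m"
    and dual: "K \<in> dual_net m N p (q(Suc \<tau> := r))" "K \<in> dual_net m N p (q(Suc \<tau> := r'))"
  shows "r = r'"
proof (rule ccontr)
  assume "r \<noteq> r'"
  obtain i where i: "(Suc \<tau>, i) \<in> idx m N" "K (Suc \<tau>, i) \<noteq> 0"
    using freqs_dest[OF K] .
  have "degree (r - r') < m"
    using r degree_diff_le_max[of r r'] by (auto simp: polys_def)
  \<comment> \<open>This \<open>f\<close> turns the coefficients of \<open>f * (r - r') / p\<close>
    into the unit vector at \<open>i\<close>, so the difference of the two sums is
    \<open>K (Suc \<tau>, i)\<close>.\<close>
  then obtain f where f: "f \<in> polys m"
    "\<And>l. l \<in> {1..m} \<Longrightarrow> lcoeff p l (f * (r - r')) = (if l = i then 1 else 0)"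
    using lcoeff_mult_surj[OF p m, of "r - r'" "\<lambda>l. if l = i then 1 else 0"] \<open>r \<noteq> r'\<close> by auto
  define S where "S g = (\<Sum>x\<in>idx m N. K x * lcoeff p (snd x) (f * (q(Suc \<tau> := g)) (fst x)))" for g
  have "S r - S r' = (\<Sum>x\<in>idx m N. if x = (Suc \<tau>, i) then K x else 0)"
    unfolding S_def sum_subtractf[symmetric]
  proof (intro sum.cong refl)
    fix x assume x: "x \<in> idx m N"
    show "K x * lcoeff p (snd x) (f * (q(Suc \<tau> := r)) (fst x))
        - K x * lcoeff p (snd x) (f * (q(Suc \<tau> := r')) (fst x))
        = (if x = (Suc \<tau>, i) then K x else 0)"
    proof (cases "fst x = Suc \<tau>")
      case True
      have "snd x \<in> {1..m}" using x by (auto simp: idx_def)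
      from f(2)[OF this]
      have "lcoeff p (snd x) (f * r) - lcoeff p (snd x) (f * r') = (if snd x = i then 1 else 0)"
        by (simp add: right_diff_distrib lcoeff_diff)
      then show ?thesis
        using True by (cases x) (auto simp flip: right_diff_distrib)
    qed auto
  qed
  also have "\<dots> = K (Suc \<tau>, i)"
    using i by simp
  finally show False
    using i dual f(1) by (simp add: dual_net_def S_def)
qed

text \<open>Expanding the product into characters and exchanging the sums over \<open>f\<close> and
  \<open>K\<close> leaves one character sum per frequency, equal to \<open>b^m\<close> on the dual
  net and \<open>0\<close> off it. Both sides are real, so the identity is proved in the complex
  numbers.\<close>

lemma criterion_eq_sum_dual_net:
  fixes p :: "'p::prime_card mod_ring poly"
  assumes m: "m \<ge> 1" and \<tau>: "\<tau> \<le> N"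
  shows "(\<Sum>f\<in>polys m. \<Prod>t = 1..\<tau>. \<Prod>i = 1..m.
            1 + eta CARD('p) (nat (to_int_mod_ring (lcoeff p i (f * q t)))) * w (t, i))
       = real CARD('p) ^ m * (\<Sum>K\<in>freqs m N \<tau> \<inter> dual_net m N p q. freq_weight m N w K)"
    (is "?lhs = ?rhs")
proof -
  define c where "c f x = lcoeff p (snd x) (f * q (fst x))" for f x
  define v where "v x \<kappa> = (if \<kappa> = 0 then 1 else w x)" for x :: "nat \<times> nat" and \<kappa> :: "'p mod_ring"
  define A where "A x = (if fst x \<le> \<tau> then UNIV else {0 :: 'p mod_ring})" for x :: "nat \<times> nat"
  have prod_eq: "complex_of_real (\<Prod>t = 1..\<tau>. \<Prod>i = 1..m.
        1 + eta CARD('p) (nat (to_int_mod_ring (lcoeff p i (f * q t)))) * w (t, i))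
      = (\<Sum>K\<in>freqs m N \<tau>. chi (\<Sum>x\<in>idx m N. K x * c f x) * of_real (freq_weight m N w K))" for f
  proof -
    have "complex_of_real (\<Prod>t = 1..\<tau>. \<Prod>i = 1..m.
        1 + eta CARD('p) (nat (to_int_mod_ring (lcoeff p i (f * q t)))) * w (t, i))
      = (\<Prod>x\<in>{1..\<tau>} \<times> {1..m}. \<Sum>\<kappa>\<in>A x. chi (\<kappa> * c f x) * of_real (v x \<kappa>))"
      unfolding prod.cartesian_product of_real_prod
      by (intro prod.cong refl)
        (auto simp: A_def c_def v_def eta_eq_sum_chi simp del: of_real_add of_real_mult)
    also have "\<dots> = (\<Prod>x\<in>idx m N. \<Sum>\<kappa>\<in>A x. chi (\<kappa> * c f x) * of_real (v x \<kappa>))"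
      using \<tau> by (intro prod.mono_neutral_left) (auto simp: idx_def A_def v_def)
    also have "\<dots> = (\<Sum>K\<in>freqs m N \<tau>. \<Prod>x\<in>idx m N. chi (K x * c f x) * of_real (v x (K x)))"
      unfolding freqs_def A_def[symmetric] by (intro prod_sum_PiE) (auto simp: A_def)
    also have "\<dots> = (\<Sum>K\<in>freqs m N \<tau>. chi (\<Sum>x\<in>idx m N. K x * c f x) * of_real (freq_weight m N w K))"
      by (intro sum.cong refl) (simp add: prod.distrib chi_sum freq_weight_def v_def)
    finally show ?thesis .
  qed
  have char_sum: "(\<Sum>f\<in>polys m. chi (\<Sum>x\<in>idx m N. K x * c f x))
      = (if K \<in> dual_net m N p q then of_nat (CARD('p) ^ m) else 0)" for K
  proof -
    have "(\<Sum>f\<in>polys m. chi (\<Sum>x\<in>idx m N. K x * c f x))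
      = (if \<forall>f\<in>polys m. (\<Sum>x\<in>idx m N. K x * c f x) = 0
         then of_nat (card (polys m :: 'p mod_ring poly set)) else 0)"
      by (intro sum_chi_additive card_polys_le)
        (auto simp: polys_def c_def degree_add_less lcoeff_add distrib_left distrib_right sum.distrib)
    then show ?thesis
      using card_polys[OF m, where 'p = 'p] by (simp add: dual_net_def c_def)
  qed
  have "complex_of_real ?lhs
      = (\<Sum>f\<in>polys m. \<Sum>K\<in>freqs m N \<tau>. chi (\<Sum>x\<in>idx m N. K x * c f x) * of_real (freq_weight m N w K))"
    by (simp only: of_real_sum prod_eq)
  also have "\<dots> = (\<Sum>K\<in>freqs m N \<tau>. (\<Sum>f\<in>polys m. chi (\<Sum>x\<in>idx m N. K x * c f x)) * of_real (freq_weight m N w K))"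
    unfolding sum_distrib_right by (rule sum.swap)
  also have "\<dots> = (\<Sum>K\<in>freqs m N \<tau> \<inter> dual_net m N p q. of_nat (CARD('p) ^ m) * of_real (freq_weight m N w K))"
    unfolding char_sum by (intro sum.mono_neutral_cong_right) auto
  also have "\<dots> = complex_of_real ?rhs"
    by (simp add: sum_distrib_left)
  finally show ?thesis
    by (simp only: of_real_eq_iff)
qed

text \<open>\<open>\<theta> r\<close> is the part of the criterion that depends on the new
  component. The minimum is compared with every candidate, each \<open>\<phi> (\<theta> r)\<close>
  is split over its dual frequencies, and in the total each new frequency occurs at most
  once.\<close>

lemma cbc_step:
  fixes p :: "'p::prime_card mod_ring poly" and \<phi> :: "real \<Rightarrow> real"
  assumes p: "irreducible p" "degree p = m" and m: "m \<ge> 1"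
    and w: "\<And>x. 0 < w x"
    and \<phi>: "concave_on {0..} \<phi>" "mono_on {0..} \<phi>"
    and r: "r0 \<in> R_set m"
    and \<theta>_def: "\<And>r. \<theta> r = (\<Sum>K\<in>(freqs m N (Suc \<tau>) - freqs m N \<tau>) \<inter> dual_net m N p (q(Suc \<tau> := r)).
                      freq_weight m N w K)"
    and min: "\<And>r. r \<in> R_set m \<Longrightarrow> \<theta> r0 \<le> \<theta> r"
  shows "(real CARD('p) ^ m - 1) * (\<phi> (\<theta> r0) - \<phi> 0)
    \<le> (\<Sum>K\<in>(freqs m N (Suc \<tau>) - freqs m N \<tau> :: (nat \<times> nat \<Rightarrow> 'p mod_ring) set).
          \<phi> (freq_weight m N w K) - \<phi> 0)"
proof -
  let ?T = "freqs m N (Suc \<tau>) - freqs m N \<tau> :: (nat \<times> nat \<Rightarrow> 'p mod_ring) set"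
  define D where "D r = ?T \<inter> dual_net m N p (q(Suc \<tau> := r))" for r
  have R: "R_set m = polys m - {0 :: 'p mod_ring poly}"
    by (auto simp: R_set_def polys_def)
  have finR: "finite (R_set m :: 'p mod_ring poly set)"
    unfolding R using card_polys_le(1) by blast
  have "0 \<in> (polys m :: 'p mod_ring poly set)"
    using m by (simp add: polys_def)
  then have cardR: "real (card (R_set m :: 'p mod_ring poly set)) = real CARD('p) ^ m - 1"
    unfolding R using m card_polys_le(1)[where 'a = "'p mod_ring", of m]
    by (simp add: card_polys of_nat_diff)
  have pos: "0 \<le> freq_weight m N w K" for K :: "nat \<times> nat \<Rightarrow> 'p mod_ring"
    using freq_weight_pos[of w m N K] w by (simp add: less_imp_le)
  have \<theta>: "\<theta> r = (\<Sum>K\<in>D r. freq_weight m N w K)" for r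
    by (simp add: \<theta>_def D_def)
  have \<theta>0: "0 \<le> \<theta> r" for r
    unfolding \<theta> by (intro sum_nonneg pos)
  have "(real CARD('p) ^ m - 1) * (\<phi> (\<theta> r0) - \<phi> 0) = (\<Sum>r\<in>(R_set m :: 'p mod_ring poly set). \<phi> (\<theta> r0) - \<phi> 0)"
    by (simp add: cardR)
  also have "\<dots> \<le> (\<Sum>r\<in>R_set m. \<phi> (\<theta> r) - \<phi> 0)"
  proof (rule sum_mono)
    fix r :: "'p mod_ring poly" assume "r \<in> R_set m"
    then show "\<phi> (\<theta> r0) - \<phi> 0 \<le> \<phi> (\<theta> r) - \<phi> 0"
      using mono_onD[OF \<phi>(2), of "\<theta> r0" "\<theta> r"] min \<theta>0 by auto
  qed
  also have "\<dots> \<le> (\<Sum>r\<in>R_set m. \<Sum>K\<in>D r. \<phi> (freq_weight m N w K) - \<phi> 0)"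
    unfolding \<theta> by (intro sum_mono concave_on_sum_le \<phi> pos) (auto simp: D_def)
  also have "\<dots> = (\<Sum>K\<in>(\<Union>r\<in>R_set m. D r). \<phi> (freq_weight m N w K) - \<phi> 0)"
  proof (rule sum.UNION_disjoint[symmetric, OF finR])
    show "\<forall>r\<in>R_set m. \<forall>r'\<in>R_set m. r \<noteq> r' \<longrightarrow> D r \<inter> D r' = {}"
      using dual_net_component_unique[OF p m, of _ N \<tau> _ _ q] by (auto simp: D_def R)
  qed (auto simp: D_def)
  \<comment> \<open>New frequencies that are dual for no candidate contribute nonnegative
    terms.\<close>
  also have "\<dots> \<le> (\<Sum>K\<in>?T. \<phi> (freq_weight m N w K) - \<phi> 0)"
  proof (rule sum_mono2)
    fix K assume "K \<in> ?T - (\<Union>r\<in>R_set m. D r)"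
    show "0 \<le> \<phi> (freq_weight m N w K) - \<phi> 0"
      using mono_onD[OF \<phi>(2), of 0 "freq_weight m N w K"] pos by auto
  qed (auto simp: D_def)
  finally show ?thesis .
qed

text \<open>Subtracting \<open>\<phi> 0\<close> makes \<open>\<phi>\<close> subadditive for empty sums as well, which matters when a
  component has no dual frequency of its own.\<close>
lemma cbc_bound:
  fixes p :: "'p::prime_card mod_ring poly" and \<phi> :: "real \<Rightarrow> real"
  assumes p: "irreducible p" "degree p = m" and m: "m \<ge> 1"
    and w: "\<And>x. 0 < w x"
    and \<phi>: "concave_on {0..} \<phi>" "mono_on {0..} \<phi>"
    and B_def: "\<And>\<tau> q. B \<tau> q = (\<Sum>K\<in>freqs m N \<tau> \<inter> dual_net m N p q - {zero_freq m N}.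
                      freq_weight m N w K)"
    and q1: "q 1 = 1"
    and min: "\<And>\<tau>. \<tau> \<in> {2..N} \<Longrightarrow>
       is_arg_min (\<lambda>r. B \<tau> (q(\<tau> := r))) (\<lambda>r. r \<in> R_set m) (q \<tau>)"
    and \<tau>: "1 \<le> \<tau>" "\<tau> \<le> N"
  shows "(real CARD('p) ^ m - 1) * (\<phi> (B \<tau> q) - \<phi> 0)
    \<le> (\<Sum>K\<in>(freqs m N \<tau> - {zero_freq m N} :: (nat \<times> nat \<Rightarrow> 'p mod_ring) set).
          \<phi> (freq_weight m N w K) - \<phi> 0)"
  using \<tau>
proof (induction \<tau> rule: dec_induct)
  case base
  \<comment> \<open>With \<open>q 1 = 1\<close> there is no nonzero dual frequency: it would also be
    dual for first component \<open>0\<close>, where every pairing vanishes, against uniqueness. The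
    polynomial \<open>0\<close> is no candidate of the algorithm, but uniqueness covers all of
    \<open>polys m\<close>.\<close>
  have "(freqs m N (Suc 0) - freqs m N 0) \<inter> dual_net m N p q = {}"
  proof (intro equals0I)
    fix K assume K: "K \<in> (freqs m N (Suc 0) - freqs m N 0) \<inter> dual_net m N p q"
    have "K \<in> dual_net m N p (q(Suc 0 := 0))"
      unfolding dual_net_def
    proof (intro CollectI ballI sum.neutral)
      fix f :: "'p mod_ring poly" and x assume "x \<in> idx m N"
      then show "K x * lcoeff p (snd x) (f * (q(Suc 0 := 0)) (fst x)) = 0"
        using freqs_eq_0[of K m N "Suc 0" x] K by (cases "fst x = Suc 0") (auto simp: idx_def)
    qed
    moreover have "K \<in> dual_net m N p (q(Suc 0 := 1))"
      using K q1 by (metis One_nat_def IntD2 fun_upd_triv)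
    ultimately have "(0 :: 'p mod_ring poly) = 1"
      using K m by (intro dual_net_component_unique[OF p m, of K N 0 _ _ q]) (auto simp: polys_def)
    then show False by simp
  qed
  then have "freqs m N (Suc 0) \<inter> dual_net m N p q - {zero_freq m N} = {}"
    unfolding freqs_0 by blast
  then have "B 1 q = 0"
    by (simp only: B_def One_nat_def sum.empty)
  moreover have "0 \<le> \<phi> (freq_weight m N w K) - \<phi> 0" for K :: "nat \<times> nat \<Rightarrow> 'p mod_ring"
    using mono_onD[OF \<phi>(2), of 0 "freq_weight m N w K"] freq_weight_pos[of w m N K] w by auto
  ultimately show ?case
    by (simp add: sum_nonneg)
next
  case (step \<tau>)
  let ?T = "freqs m N (Suc \<tau>) - freqs m N \<tau> :: (nat \<times> nat \<Rightarrow> 'p mod_ring) set"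
  have sub: "freqs m N \<tau> \<subseteq> (freqs m N (Suc \<tau>) :: (nat \<times> nat \<Rightarrow> 'p mod_ring) set)"
    by (rule freqs_mono) simp
  define \<theta> where "\<theta> r = (\<Sum>K\<in>?T \<inter> dual_net m N p (q(Suc \<tau> := r)). freq_weight m N w K)" for r
  have split: "B (Suc \<tau>) (q(Suc \<tau> := r)) = B \<tau> q + \<theta> r" for r
  proof -
    have "freqs m N (Suc \<tau>) \<inter> dual_net m N p (q(Suc \<tau> := r)) - {zero_freq m N}
        = (freqs m N \<tau> \<inter> dual_net m N p q - {zero_freq m N})
          \<union> (?T \<inter> dual_net m N p (q(Suc \<tau> := r)))"
      using sub zero_freq_in_freqs[of m N \<tau>] dual_net_cong[of _ m N \<tau> q "q(Suc \<tau> := r)" p] by auto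
    then show ?thesis
      unfolding B_def \<theta>_def by (simp only:) (rule sum.union_disjoint, auto)
  qed
  \<comment> \<open>\<open>B \<tau> q\<close> does not depend on \<open>r\<close>, so minimising the
    criterion means minimising \<open>\<theta>\<close>.\<close>
  have argmin: "q (Suc \<tau>) \<in> R_set m" "\<And>r. r \<in> R_set m \<Longrightarrow> \<theta> (q (Suc \<tau>)) \<le> \<theta> r"
    using min[of "Suc \<tau>"] step.hyps step.prems by (auto simp: is_arg_min_linorder split)
  have pos: "0 \<le> freq_weight m N w K" for K :: "nat \<times> nat \<Rightarrow> 'p mod_ring"
    using freq_weight_pos[of w m N K] w by (simp add: less_imp_le)
  have "\<phi> (B (Suc \<tau>) q) - \<phi> 0 \<le> (\<phi> (B \<tau> q) - \<phi> 0) + (\<phi> (\<theta> (q (Suc \<tau>))) - \<phi> 0)"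
    using concave_on_subadditive[OF \<phi>(1), of "B \<tau> q" "\<theta> (q (Suc \<tau>))"] split[of "q (Suc \<tau>)"] pos
    by (simp add: B_def \<theta>_def sum_nonneg)
  then have "(real CARD('p) ^ m - 1) * (\<phi> (B (Suc \<tau>) q) - \<phi> 0)
      \<le> (real CARD('p) ^ m - 1) * ((\<phi> (B \<tau> q) - \<phi> 0) + (\<phi> (\<theta> (q (Suc \<tau>))) - \<phi> 0))"
    by (intro mult_left_mono) auto
  also have "\<dots> \<le> (\<Sum>K\<in>(freqs m N \<tau> - {zero_freq m N} :: (nat \<times> nat \<Rightarrow> 'p mod_ring) set).
          \<phi> (freq_weight m N w K) - \<phi> 0) + (\<Sum>K\<in>?T. \<phi> (freq_weight m N w K) - \<phi> 0)"
    unfolding distrib_left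
    using step.prems
    by (intro add_mono step.IH cbc_step[OF p m w \<phi> argmin(1) \<theta>_def argmin(2)]) auto
  also have "\<dots> = (\<Sum>K\<in>(freqs m N \<tau> - {zero_freq m N}) \<union> ?T. \<phi> (freq_weight m N w K) - \<phi> 0)"
    by (rule sum.union_disjoint[symmetric]) auto
  also have "(freqs m N \<tau> - {zero_freq m N}) \<union> ?T = freqs m N (Suc \<tau>) - {zero_freq m N}"
    using sub zero_freq_in_freqs[of m N \<tau>] by auto
  finally show ?case .
qed

section \<open>Interlacing of digits\<close>

text \<open>\<open>Suc ((t - 1) div d)\<close> and \<open>Suc ((t - 1) mod d)\<close> recover
  \<open>j\<close> and \<open>h\<close> from \<open>t = d (j - 1) + h\<close>. The value is the
  reciprocal of the denominator in \<open>B_factor\<close>.\<close>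

definition pos_weight :: "nat \<Rightarrow> nat \<Rightarrow> (nat \<Rightarrow> real) \<Rightarrow> nat \<times> nat \<Rightarrow> real" where
  "pos_weight b d a x =
     real b powr - (real (d * (snd x - 1) + Suc ((fst x - 1) mod d)) + a (Suc ((fst x - 1) div d)))"

text \<open>Splits a product over \<open>t\<close> into \<open>c\<close> full blocks and a last
  block of length \<open>r\<close>, the shape of the criterion. Allowing \<open>r = d\<close> covers
  a full last block and drives the induction on \<open>c\<close>.\<close>

lemma prod_blocks:
  fixes g :: "nat \<Rightarrow> nat \<Rightarrow> 'a::comm_monoid_mult"
  assumes d: "d \<ge> 1"
  shows "r \<le> d \<Longrightarrow> (\<Prod>t = 1..d * c + r. g (Suc ((t - 1) div d)) (Suc ((t - 1) mod d)))
    = (\<Prod>j = 1..c. \<Prod>h = 1..d. g j h) * (\<Prod>h = 1..r. g (Suc c) h)"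
proof (induction c arbitrary: r)
  case 0
  then have "(\<Prod>t = 1..r. g (Suc ((t - 1) div d)) (Suc ((t - 1) mod d))) = (\<Prod>h = 1..r. g (Suc 0) h)"
    by (intro prod.cong refl) auto
  then show ?case by simp
next
  case (Suc c)
  have *: "(\<Prod>t = 1..d * Suc c. g (Suc ((t - 1) div d)) (Suc ((t - 1) mod d)))
      = (\<Prod>j = 1..Suc c. \<Prod>h = 1..d. g j h)"
    using Suc.IH[of d] by (simp add: add.commute)
  from Suc.prems show ?case
  proof (induction r)
    case 0
    then show ?case using * by simp
  next
    case (Suc r)
    have "(d * Suc c + r) div d = Suc c" "(d * Suc c + r) mod d = r"
      using Suc.prems div_mult_self4[of d "Suc c" r] mod_mult_self4[of d "Suc c" r] by simp_all
    with Suc show ?case by (simp add: mult.assoc)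
  qed
qed

lemma ceiling_divide_nat:
  assumes "d \<ge> 1" "\<tau> \<ge> 1"
  shows "nat \<lceil>real \<tau> / real d\<rceil> = Suc ((\<tau> - 1) div d)"
proof -
  define c where "c = (\<tau> - 1) div d"
  have "c * d \<le> \<tau> - 1" "\<tau> - 1 < Suc c * d"
    using assms by (auto simp: c_def dividend_less_div_times mult.commute dividend_less_times_div)
  then have "c * d < \<tau>" "\<tau> \<le> Suc c * d"
    using assms by linarith+
  then have "real c * real d < real \<tau>" "real \<tau> \<le> (real c + 1) * real d"
    by (simp_all flip: of_nat_mult of_nat_Suc of_nat_1 of_nat_add)
  then have "\<lceil>real \<tau> / real d\<rceil> = int c + 1"
    using assms by (intro ceiling_unique) (simp_all add: field_simps)
  then show ?thesis by (simp add: c_def)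
qed

lemma B_crit_eq_sum_dual_net:
  fixes p :: "'p::prime_card mod_ring poly"
  assumes m: "m \<ge> 1" and d: "d \<ge> 1" and \<tau>: "1 \<le> \<tau>" "\<tau> \<le> N"
  shows "B_crit u m d \<tau> q p = (\<Sum>K\<in>freqs m N \<tau> \<inter> dual_net m N p q - {zero_freq m N}.
           freq_weight m N (pos_weight CARD('p) d (a_seq CARD('p) u)) K)"
proof -
  define w where "w = pos_weight CARD('p) d (a_seq CARD('p) u)"
  define c where "c = (\<tau> - 1) div d"
  \<comment> \<open>Division is applied to \<open>\<tau> - 1\<close>, so \<open>r\<close> lies
    between 1 and \<open>d\<close>: when \<open>d\<close> divides \<open>\<tau>\<close> the last
    block is full, not empty.\<close>
  define r where "r = Suc ((\<tau> - 1) mod d)"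
  have r: "r \<le> d" using d by (simp add: r_def Suc_le_eq)
  have \<tau>_eq: "\<tau> = d * c + r" using \<tau> by (simp add: c_def r_def)
  define F where "F f = (\<Prod>t = 1..\<tau>. \<Prod>i = 1..m.
      1 + eta CARD('p) (nat (to_int_mod_ring (lcoeff p i (f * q t)))) * w (t, i))" for f
  have factor: "(\<Prod>j = 1..c. \<Prod>h = 1..d. B_factor u m d q p n j h)
      * (\<Prod>h = 1..r. B_factor u m d q p n (Suc c) h) = F (poly_of_nat m n)" for n
  proof -
    have "(\<Prod>j = 1..c. \<Prod>h = 1..d. B_factor u m d q p n j h) * (\<Prod>h = 1..r. B_factor u m d q p n (Suc c) h)
      = (\<Prod>t = 1..\<tau>. B_factor u m d q p n (Suc ((t - 1) div d)) (Suc ((t - 1) mod d)))"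
      unfolding \<tau>_eq by (rule prod_blocks[OF d r, symmetric])
    also have "\<dots> = F (poly_of_nat m n)"
      unfolding F_def
    proof (intro prod.cong refl)
      fix t assume t: "t \<in> {1..\<tau>}"
      then have t_eq: "d * (Suc ((t - 1) div d) - 1) + Suc ((t - 1) mod d) = t"
        by simp
      have w_eq: "w (t, i) = inverse (real CARD('p) powr
          (real (d * (i - 1) + Suc ((t - 1) mod d)) + a_seq CARD('p) u (Suc ((t - 1) div d))))" for i
        by (simp only: w_def pos_weight_def powr_minus fst_conv snd_conv)
      show "B_factor u m d q p n (Suc ((t - 1) div d)) (Suc ((t - 1) mod d))
        = (\<Prod>i = 1..m. 1 + eta CARD('p) (nat (to_int_mod_ring (lcoeff p i (poly_of_nat m n * q t)))) * w (t, i))"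
        unfolding B_factor_def Let_def
        by (intro prod.cong refl) (simp only: badic_digit_lattice_coord t_eq w_eq divide_inverse)
    qed
    finally show ?thesis .
  qed
  have "nat \<lceil>real \<tau> / real d\<rceil> = Suc c"
    using ceiling_divide_nat[OF d \<tau>(1)] by (simp only: c_def)
  moreover have "\<tau> - d * c = r"
    using \<tau>_eq by linarith
  ultimately have "B_crit u m d \<tau> q p = -1 + 1 / real CARD('p) ^ m * (\<Sum>n<CARD('p) ^ m. F (poly_of_nat m n))"
    by (simp only: B_crit_def Let_def diff_Suc_1 factor)
  also have "(\<Sum>n<CARD('p) ^ m. F (poly_of_nat m n)) = (\<Sum>f\<in>polys m. F f)"
    by (rule sum.reindex_bij_betw[OF bij_betw_poly_of_nat[OF m]])
  also have "\<dots> = real CARD('p) ^ m * (\<Sum>K\<in>freqs m N \<tau> \<inter> dual_net m N p q. freq_weight m N w K)"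
    unfolding F_def by (rule criterion_eq_sum_dual_net[OF m \<tau>(2)])
  \<comment> \<open>The zero frequency is always dual and has weight 1, which cancels the
    \<open>-1\<close> of the criterion.\<close>
  also have "(\<Sum>K\<in>freqs m N \<tau> \<inter> dual_net m N p q. freq_weight m N w K)
      = 1 + (\<Sum>K\<in>freqs m N \<tau> \<inter> dual_net m N p q - {zero_freq m N}. freq_weight m N w K)"
    using zero_freq_in_freqs[of m N \<tau>] zero_freq_in_dual_net[of m N p q]
    by (subst sum.remove[of _ "zero_freq m N"]) auto
  finally show ?thesis
    by (simp add: w_def)
qed

text \<open>Digit interlacing: the digits of each \<open>k j\<close> are dealt out cyclically to its
  \<open>d\<close> components. The exponent is one less than the position
  \<open>c = d (i - 1) + h\<close>.\<close>

definition digit_freq :: "nat \<Rightarrow> nat \<Rightarrow> nat \<Rightarrow> (nat \<Rightarrow> nat) \<Rightarrow> nat \<times> nat \<Rightarrow> 'p::prime_card mod_ring" where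
  "digit_freq m s d k = (\<lambda>x\<in>idx m (d * s).
     of_nat (k (Suc ((fst x - 1) div d)) div CARD('p) ^ (d * (snd x - 1) + (fst x - 1) mod d) mod CARD('p)))"

text \<open>Positions \<open>(t, i)\<close> with \<open>t = d (j - 1) + h\<close> correspond to the digit at
  \<open>c = d (i - 1) + h\<close> of the \<open>j\<close>-th component.\<close>
lemma interlace_bij:
  assumes d: "d \<ge> 1"
  shows "(t, i) \<in> idx m (d * s) \<Longrightarrow>
      (Suc ((t - 1) div d), Suc (d * (i - 1) + (t - 1) mod d)) \<in> {1..s} \<times> {1..d * m}"
    and "(j, c) \<in> {1..s} \<times> {1..d * m} \<Longrightarrow>
      (Suc (d * (j - 1) + (c - 1) mod d), Suc ((c - 1) div d)) \<in> idx m (d * s)"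
proof -
  have bound: "d * x + y mod d < d * n" if "x < n" for x y n :: nat
  proof -
    have "d * x + y mod d < d * x + d" using d by simp
    also have "\<dots> = d * Suc x" by simp
    also have "\<dots> \<le> d * n" using that by (intro mult_le_mono2) simp
    finally show ?thesis .
  qed
  show "(Suc ((t - 1) div d), Suc (d * (i - 1) + (t - 1) mod d)) \<in> {1..s} \<times> {1..d * m}"
    if "(t, i) \<in> idx m (d * s)"
  proof -
    have ti: "t - 1 < d * s" "i - 1 < m" using that by (auto simp: idx_def)
    then have "(t - 1) div d < s" using d by (simp add: less_mult_imp_div_less mult.commute)
    with bound[OF ti(2)] show ?thesis by (simp add: Suc_le_eq)
  qed
  show "(Suc (d * (j - 1) + (c - 1) mod d), Suc ((c - 1) div d)) \<in> idx m (d * s)"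
    if "(j, c) \<in> {1..s} \<times> {1..d * m}"
  proof -
    have jc: "j - 1 < s" "c - 1 < d * m" using that by auto
    then have "(c - 1) div d < m" using d by (simp add: less_mult_imp_div_less mult.commute)
    with bound[OF jc(1)] show ?thesis by (simp add: idx_def Suc_le_eq)
  qed
qed

text \<open>Every digit of every \<open>k j\<close> occurs at some index pair, which gives
  injectivity; both sides have \<open>b^(d m s)\<close> elements, which gives surjectivity.\<close>

lemma bij_betw_digit_freq:
  assumes d: "d \<ge> 1"
  shows "bij_betw (digit_freq m s d)
    ({1..s} \<rightarrow>\<^sub>E {..<CARD('p) ^ (d * m)})
    (freqs m (d * s) (d * s) :: (nat \<times> nat \<Rightarrow> 'p::prime_card mod_ring) set)"
proof -
  let ?A = "{1..s} \<rightarrow>\<^sub>E {..<CARD('p) ^ (d * m)}"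
  let ?T = "digit_freq m s d :: (nat \<Rightarrow> nat) \<Rightarrow> nat \<times> nat \<Rightarrow> 'p mod_ring"
  have freqs: "freqs m (d * s) (d * s) = idx m (d * s) \<rightarrow>\<^sub>E (UNIV :: 'p mod_ring set)"
    unfolding freqs_def by (intro PiE_cong) (auto simp: idx_def)
  have inj: "inj_on ?T ?A"
  proof (rule inj_onI)
    fix k k' assume k: "k \<in> ?A" "k' \<in> ?A" "?T k = ?T k'"
    show "k = k'"
    proof (rule PiE_ext[OF k(1,2)])
      fix j assume j: "j \<in> {1..s}"
      show "k j = k' j"
      proof (rule nat_digits_unique)
        show "k j < CARD('p) ^ (d * m)" "k' j < CARD('p) ^ (d * m)"
          using PiE_mem[OF k(1) j] PiE_mem[OF k(2) j] by auto
        fix e assume e: "e < d * m"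
        define x where "x = (Suc (d * (j - 1) + e mod d), Suc (e div d))"
        have "x \<in> idx m (d * s)"
          using interlace_bij(2)[OF d, of j "Suc e" s m] j e by (simp add: x_def)
        moreover have "Suc ((fst x - 1) div d) = j" "d * (snd x - 1) + (fst x - 1) mod d = e"
          using d j by (simp_all add: x_def)
        ultimately have "?T k x = of_nat (k j div CARD('p) ^ e mod CARD('p))"
          "?T k' x = of_nat (k' j div CARD('p) ^ e mod CARD('p))"
          by (simp_all only: digit_freq_def restrict_apply if_True)
        with k(3) have "(of_nat (k j div CARD('p) ^ e mod CARD('p)) :: 'p mod_ring)
            = of_nat (k' j div CARD('p) ^ e mod CARD('p))"
          by simp
        then show "k j div CARD('p) ^ e mod CARD('p) = k' j div CARD('p) ^ e mod CARD('p)"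
          by (rule of_nat_mod_ring_inj[rotated 2]) simp_all
      qed
    qed
  qed
  have "card (?T ` ?A) = (CARD('p) ^ (d * m)) ^ s"
    using card_image[OF inj] by (simp add: card_PiE)
  also have "\<dots> = card (freqs m (d * s) (d * s) :: (nat \<times> nat \<Rightarrow> 'p mod_ring) set)"
    unfolding freqs by (simp add: card_PiE idx_def power_mult[symmetric] ac_simps)
  finally have "?T ` ?A = freqs m (d * s) (d * s)"
    by (intro card_subset_eq finite_freqs) (auto simp: freqs digit_freq_def)
  with inj show ?thesis by (simp add: bij_betw_def)
qed

lemma digit_freq_zero: "digit_freq m s d (\<lambda>j\<in>{1..s}. 0) = zero_freq m (d * s)"
proof -
  have "Suc ((fst x - 1) div d) \<in> {1..s}" if "x \<in> idx m (d * s)" for x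
  proof -
    have "1 \<le> fst x" "fst x \<le> d * s"
      using that by (auto simp: idx_def)
    then have "fst x - 1 < s * d"
      by (simp add: mult.commute)
    then show ?thesis
      using less_mult_imp_div_less by (simp add: Suc_le_eq)
  qed
  then show ?thesis
    unfolding digit_freq_def by (intro restrict_ext) (simp del: atLeastAtMost_iff)
qed

text \<open>\<open>b^(-\<mu>)\<close> is a product over the nonzero digits of all
  \<open>k j\<close>, and interlacing only permutes its factors.\<close>

lemma freq_weight_digit_freq:
  assumes d: "d \<ge> 1" and k: "k \<in> {1..s} \<rightarrow>\<^sub>E {..<CARD('p::prime_card) ^ (d * m)}"
  shows "freq_weight m (d * s) (pos_weight CARD('p) d a) (digit_freq m s d k :: _ \<Rightarrow> 'p mod_ring)
    = real CARD('p) powr - mu_vec CARD('p) s a k"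
proof -
  let ?b = "CARD('p)"
  define dig where "dig j c = k j div ?b ^ (c - 1) mod ?b" for j c
  define g where "g j c = (if dig j c = 0 then 1 else real ?b powr - (real c + a j))" for j c
  have b: "?b > 0" by simp
  have "real ?b powr - mu_vec ?b s a k = (\<Prod>j = 1..s. real ?b powr - mu ?b (a j) (k j))"
    by (simp add: mu_vec_def powr_sum flip: sum_negf)
  also have "\<dots> = (\<Prod>j = 1..s. \<Prod>c = 1..d * m. g j c)"
  proof (intro prod.cong refl)
    fix j assume "j \<in> {1..s}"
    with k have kj: "k j < ?b ^ (d * m)" by auto
    have "c \<le> d * m" if "1 \<le> c" "dig j c \<noteq> 0" for c
    proof (rule ccontr)
      \<comment> \<open>Digits beyond position \<open>d * m\<close> vanish because
        \<open>k j < b^(d m)\<close>, so the digit set in \<open>mu\<close> is finite and inside the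
        interlaced range.\<close>
      assume "\<not> c \<le> d * m"
      then have "?b ^ (d * m) \<le> ?b ^ (c - 1)"
        using b by (intro power_increasing) auto
      with kj that show False by (simp add: dig_def)
    qed
    then have S: "{c. 1 \<le> c \<and> k j div ?b ^ (c - 1) mod ?b \<noteq> 0} = {c\<in>{1..d * m}. dig j c \<noteq> 0}"
      by (auto simp: dig_def)
    have "real ?b powr - mu ?b (a j) (k j) = (\<Prod>c\<in>{c\<in>{1..d * m}. dig j c \<noteq> 0}. real ?b powr - (real c + a j))"
      unfolding mu_def S by (simp add: powr_sum flip: sum_negf)
    also have "\<dots> = (\<Prod>c = 1..d * m. g j c)"
      by (intro prod.mono_neutral_cong_left) (auto simp: g_def)
    finally show "real ?b powr - mu ?b (a j) (k j) = (\<Prod>c = 1..d * m. g j c)" .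
  qed
  also have "\<dots> = (\<Prod>(j, c)\<in>{1..s} \<times> {1..d * m}. g j c)"
    by (simp add: prod.cartesian_product)
  also have "\<dots> = (\<Prod>(t, i)\<in>idx m (d * s). g (Suc ((t - 1) div d)) (Suc (d * (i - 1) + (t - 1) mod d)))"
    by (rule prod.reindex_bij_witness[of _
          "\<lambda>(t, i). (Suc ((t - 1) div d), Suc (d * (i - 1) + (t - 1) mod d))"
          "\<lambda>(j, c). (Suc (d * (j - 1) + (c - 1) mod d), Suc ((c - 1) div d))"])
      (use interlace_bij[OF d] d in \<open>auto simp: idx_def\<close>)
  also have "\<dots> = freq_weight m (d * s) (pos_weight ?b d a) (digit_freq m s d k :: _ \<Rightarrow> 'p mod_ring)"
    unfolding freq_weight_def
  proof (intro prod.cong refl)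
    fix x assume x: "x \<in> idx m (d * s)"
    obtain t i where ti: "x = (t, i)" by (cases x)
    define j where "j = Suc ((t - 1) div d)"
    define c where "c = Suc (d * (i - 1) + (t - 1) mod d)"
    have "(digit_freq m s d k :: _ \<Rightarrow> 'p mod_ring) x = of_nat (dig j c)"
      using x by (simp add: digit_freq_def dig_def ti j_def c_def)
    moreover have "(of_nat (dig j c) :: 'p mod_ring) = 0 \<longleftrightarrow> dig j c = 0"
      using of_nat_mod_ring_inj[where 'p = 'p, of "dig j c" 0] b by (auto simp: dig_def)
    moreover have "pos_weight ?b d a x = real ?b powr - (real c + a j)"
      by (simp add: pos_weight_def ti j_def c_def)
    ultimately have "g j c
        = (if (digit_freq m s d k :: _ \<Rightarrow> 'p mod_ring) x = 0 then 1 else pos_weight ?b d a x)"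
      by (simp add: g_def)
    then show "(case x of (t, i) \<Rightarrow> g (Suc ((t - 1) div d)) (Suc (d * (i - 1) + (t - 1) mod d)))
        = (if (digit_freq m s d k :: _ \<Rightarrow> 'p mod_ring) x = 0 then 1 else pos_weight ?b d a x)"
      by (simp only: ti prod.case j_def c_def)
  qed
  finally show ?thesis by simp
qed

theorem theorem2:
  fixes b m s d :: nat
    and u :: "nat \<Rightarrow> real"
    and p :: "'p::prime_card mod_ring poly"
    and q :: "nat \<Rightarrow> 'p mod_ring poly"
    and \<phi> :: "real \<Rightarrow> real"
  assumes "prime b" and "CARD('p) = b"
    and "m \<ge> 1" and "s \<ge> 1" and "d \<ge> 1"
    and "\<And>j. j \<ge> 1 \<Longrightarrow> u j > 0"
    and "\<And>i j. 1 \<le> i \<Longrightarrow> i \<le> j \<Longrightarrow> u j \<le> u i"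
    and "irreducible p" and "degree p = m"
    and "\<phi> \<in> {0..} \<rightarrow> {0..}"
    and "concave_on {0..} \<phi>"
    and "\<not> bdd_above (\<phi> ` {0..})"
    and "mono_on {0..} \<phi>"
    and "cbc_constructed u m s d p q"
  shows "B_crit u m d (d * s) q p
    \<le> inv_into {0..} \<phi>
        (1 / (real b ^ m - 1) *
          (\<Sum>k\<in>({1..s} \<rightarrow>\<^sub>E {..<b ^ (d * m)}) - {\<lambda>j\<in>{1..s}. 0}.
             \<phi> (real b powr (- mu_vec b s (a_seq b u) k))))"
proof -
  note b [simp] = \<open>CARD('p) = b\<close>[symmetric]
  note \<phi> = \<open>concave_on {0..} \<phi>\<close> \<open>mono_on {0..} \<phi>\<close>
  define N where "N = d * s"
  define w where "w = pos_weight b d (a_seq b u)"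
  define FR where "FR = (freqs m N N - {zero_freq m N} :: (nat \<times> nat \<Rightarrow> 'p mod_ring) set)"
  define W where "W = (freq_weight m N w :: (nat \<times> nat \<Rightarrow> 'p mod_ring) \<Rightarrow> real)"
  define M where "M = real b ^ m - 1"
  define y where "y = 1 / M * (\<Sum>K\<in>FR. \<phi> (W K))"
  have "b > 1" using \<open>prime b\<close> prime_gt_1_nat by blast
  have "N \<ge> 1" using assms(4,5) by (simp add: N_def)
  have w_pos: "0 < w x" for x
    using \<open>b > 1\<close> by (simp add: w_def pos_weight_def)
  have W_pos: "0 < W K" for K
    unfolding W_def using w_pos by (simp add: freq_weight_pos)
  have M_pos: "M > 0"
    using \<open>b > 1\<close> \<open>m \<ge> 1\<close> by (simp add: M_def)

  \<comment> \<open>Interlacing turns the sum over \<open>k\<close> in the statement into a sum over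
    the nonzero frequencies.\<close>
  have "bij_betw (digit_freq m s d) (({1..s} \<rightarrow>\<^sub>E {..<b ^ (d * m)}) - {\<lambda>j\<in>{1..s}. 0}) FR"
    unfolding FR_def N_def b
  proof (rule bij_betw_DiffI[OF bij_betw_digit_freq[OF \<open>d \<ge> 1\<close>]])
    show "bij_betw (digit_freq m s d) {\<lambda>j\<in>{1..s}. 0} {zero_freq m (d * s) :: _ \<Rightarrow> 'p mod_ring}"
      by (intro bij_betw_singletonI digit_freq_zero)
  qed (auto simp: zero_freq_in_freqs restrict_PiE_iff)
  then have "(\<Sum>k\<in>({1..s} \<rightarrow>\<^sub>E {..<b ^ (d * m)}) - {\<lambda>j\<in>{1..s}. 0}. \<phi> (W (digit_freq m s d k)))
      = (\<Sum>K\<in>FR. \<phi> (W K))"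
    by (rule sum.reindex_bij_betw)
  moreover have "W (digit_freq m s d k) = real b powr - mu_vec b s (a_seq b u) k"
    if "k \<in> {1..s} \<rightarrow>\<^sub>E {..<b ^ (d * m)}" for k
    using freq_weight_digit_freq[where 'p = 'p, OF \<open>d \<ge> 1\<close>, of k s m] that
    by (simp add: W_def w_def N_def)
  ultimately have y_eq: "1 / (real b ^ m - 1) *
      (\<Sum>k\<in>({1..s} \<rightarrow>\<^sub>E {..<b ^ (d * m)}) - {\<lambda>j\<in>{1..s}. 0}. \<phi> (real b powr (- mu_vec b s (a_seq b u) k))) = y"
    by (simp add: y_def M_def)

  define B where "B \<tau> r = (\<Sum>K\<in>freqs m N \<tau> \<inter> dual_net m N p r - {zero_freq m N}. freq_weight m N w K)"
    for \<tau> and r :: "nat \<Rightarrow> 'p mod_ring poly"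
  have B: "B_crit u m d \<tau> r p = B \<tau> r" if "1 \<le> \<tau>" "\<tau> \<le> N" for \<tau> r
    unfolding B_def w_def b by (rule B_crit_eq_sum_dual_net[OF \<open>m \<ge> 1\<close> \<open>d \<ge> 1\<close> that])
  have "(real CARD('p) ^ m - 1) * (\<phi> (B N q) - \<phi> 0) \<le> (\<Sum>K\<in>FR. \<phi> (freq_weight m N w K) - \<phi> 0)"
    unfolding FR_def
  proof (rule cbc_bound[OF \<open>irreducible p\<close> \<open>degree p = m\<close> \<open>m \<ge> 1\<close> w_pos \<phi> B_def])
    show "q 1 = 1"
      using \<open>cbc_constructed u m s d p q\<close> by (simp add: cbc_constructed_def)
    fix \<tau> assume "\<tau> \<in> {2..N}"
    then show "is_arg_min (\<lambda>r. B \<tau> (q(\<tau> := r))) (\<lambda>r. r \<in> R_set m) (q \<tau>)"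
      using \<open>cbc_constructed u m s d p q\<close> by (simp add: cbc_constructed_def N_def[symmetric] B)
  qed (use \<open>N \<ge> 1\<close> in auto)
  moreover have My: "M * y = (\<Sum>K\<in>FR. \<phi> (W K))"
    using M_pos by (simp add: y_def)
  ultimately have *: "M * (\<phi> (B N q) - \<phi> 0) \<le> M * y - card FR * \<phi> 0"
    by (simp add: M_def W_def sum_subtractf)

  have "card (freqs m N N :: (nat \<times> nat \<Rightarrow> 'p mod_ring) set) = b ^ (d * m * s)"
    using bij_betw_same_card[OF bij_betw_digit_freq[where 'p = 'p, OF \<open>d \<ge> 1\<close>, of m s]]
    by (simp add: card_PiE N_def power_mult)
  then have "card FR = b ^ (d * m * s) - 1"
    using zero_freq_in_freqs[where 'a = "'p mod_ring", of m N N] by (simp add: FR_def)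
  moreover have "b ^ m \<le> b ^ (d * m * s)"
    using \<open>b > 1\<close> assms(4,5) by (intro power_increasing) auto
  ultimately have card: "M \<le> card FR"
    using \<open>b > 1\<close> by (simp add: M_def of_nat_diff)
  have fin: "finite FR" by (simp add: FR_def)
  have "FR \<noteq> {}" using card M_pos by auto

  have \<phi>0: "0 \<le> \<phi> x" if "0 \<le> x" for x
    using \<open>\<phi> \<in> {0..} \<rightarrow> {0..}\<close> that by auto
  have le_y: "\<phi> (B N q) \<le> y"
  proof -
    have "M * \<phi> 0 \<le> card FR * \<phi> 0"
      using card \<phi>0[of 0] by (intro mult_right_mono) auto
    with * have "M * \<phi> (B N q) \<le> M * y"
      by (simp add: algebra_simps)
    with M_pos show ?thesis by simp
  qed
  \<comment> \<open>The least weight is a positive point with \<open>\<phi> x0 \<le> y\<close>: the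
    sum has at least \<open>M\<close> terms, each at least \<open>\<phi> x0\<close>. This puts
    \<open>y\<close> in the range of \<open>\<phi>\<close>, where \<open>inv_into\<close> is a true
    inverse.\<close>
  define x0 where "x0 = Min (W ` FR)"
  have "x0 \<in> W ` FR" unfolding x0_def using fin \<open>FR \<noteq> {}\<close> by (intro Min_in) auto
  then have x0: "0 < x0" using W_pos by auto
  have "M * \<phi> x0 \<le> card FR * \<phi> x0"
    using card \<phi>0[of x0] x0 by (intro mult_right_mono) auto
  also have "\<dots> = (\<Sum>K\<in>FR. \<phi> x0)" by simp
  also have "\<dots> \<le> (\<Sum>K\<in>FR. \<phi> (W K))"
    using fin x0 W_pos by (intro sum_mono mono_onD[OF \<phi>(2)]) (auto simp: x0_def less_imp_le)
  also have "\<dots> = M * y" by (simp add: My)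
  finally have "\<phi> x0 \<le> y" using M_pos by simp
  then have "y \<in> \<phi> ` {0..}"
    using concave_mono_unbounded_attains[OF \<phi>(1) assms(12) \<phi>(2) x0] by simp
  then have x: "inv_into {0..} \<phi> y \<in> {0..}" "\<phi> (inv_into {0..} \<phi> y) = y"
    by (rule inv_into_into, rule f_inv_into_f)
  have "B N q \<le> inv_into {0..} \<phi> y"
  proof (rule ccontr)
    assume "\<not> ?thesis"
    then have "y < \<phi> (B N q)"
      using concave_mono_unbounded_strict[OF \<phi> assms(12), of "inv_into {0..} \<phi> y" "B N q"] x by simp
    with le_y show False by simp
  qed
  then show ?thesis
    unfolding y_eq using B[of N q] \<open>N \<ge> 1\<close> by (simp add: N_def)
qed

end
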